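(* Let $(V,\|\cdot\|)$ be a finite-dimensional real normed space with dual unit ball $B^\circ\subset V^*$. Then the set of Busemann points of $(V,\|\cdot\|)$ is $$\{\, f_{E,p}^* \mid E \text{ is a proper extreme set of } B^\circ \text{ and } p\in V \,\}.$$
   Context: $V$ is a finite-dimensional real vector space with norm $\|\cdot\|$ and metric $d(x,y)=\|x-y\|$; $V^*$ is its dual space, with pairing $\langle y|x\rangle$ for $y\in V^*$, $x\in V$. The unit ball is $B=\{x\in V: \|x\|\le 1\}$ and the dual unit ball is $B^\circ=\{y\in V^* : \langle y|x\rangle\ge -1 \text{ for all } x\in B\}$. Extreme sets: a convex subset $E$ of a convex set $C$ is an extreme set of $C$ if, whenever an interior point of a line segment contained in $C$ belongs to $E$, both endpoints of the segment belong to $E$. Extreme sets are understood to be nonempty. A proper extreme set of $C$ is one different from $C$ (the set $C$ is an extreme set of itself). The functions $f_{E,p}$: for an extreme set $E$ of $B^\circ$ and $p\in V$, define $f_{E,p}:V^*\to[0,\infty]$ by $f_{E,p}(q)=I_E(q)+\langle q|p\rangle-\inf_{y\in E}\langle y|p\rangle$, where $I_E$ is $0$ on $E$ and $+\infty$ elsewhere. Its Legendre–Fenchel transform is the function $f_{E,p}^*$ on $V$ given by $f_{E,p}^*(x)=\sup_{q\in V^*}\big(\langle q|x\rangle-f_{E,p}(q)\big)$. Horofunctions: for $z\in V$ let $\phi_z(x)=\|z-x\|-\|z\|$, $x\in V$, and let $\mathcal D=\{\phi_z: z\in V\}$. Let $\operatorname{cl}\mathcal D$ be the closure of $\mathcal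 D$ in the space of continuous real-valued functions on $V$ with the topology of uniform convergence on compact sets. The horofunction boundary of $V$ is $(\operatorname{cl}\mathcal D)\setminus\mathcal D$, and its elements are called horofunctions (thus horofunctions are normalised to take the value $0$ at the origin). Busemann points: an almost-geodesic is a map $\gamma:T\to V$, where $T\subset[0,\infty)$ is an unbounded set containing $0$, such that for every $\epsilon>0$, $|d(\gamma(t),\gamma(s))+d(\gamma(s),\gamma(0))-t|<\epsilon$ for all sufficiently large $s,t\in T$ with $t\ge s$. A Busemann point is a horofunction $h$ for which there is an almost-geodesic $\gamma$ such that $\phi_{\gamma(t)}\to h$ uniformly on compact sets as $t\to\infty$ in $T$. *)

theory Defs
  imports "HOL-Analysis.Analysis"
begin

text \<open>
  The dual space of \<open>V\<close> is the type \<open>'a \<Rightarrow>\<^sub>L real\<close> of bounded functionals: on a finite-dimensional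
  normed space every linear functional is bounded.
  Extreme sets are the library's \<open>face_of\<close>, which already includes convexity; nonemptiness has
  to be required in addition.
\<close>

definition dual_ball :: "('a::real_normed_vector \<Rightarrow>\<^sub>L real) set" where
  "dual_ball = {y. \<forall>x\<in>cball 0 1. blinfun_apply y x \<ge> -1}"

text \<open>
  For nonempty \<open>E \<subseteq> dual_ball\<close> the infimum is finite, so no \<open>\<infinity> - \<infinity>\<close> occurs, and the values are
  nonnegative.
\<close>

definition face_fun ::
  "('a::real_normed_vector \<Rightarrow>\<^sub>L real) set \<Rightarrow> 'a \<Rightarrow> ('a \<Rightarrow>\<^sub>L real) \<Rightarrow> ereal" where
  "face_fun E p q =
     (if q \<in> E then 0 else \<infinity>) + ereal (blinfun_apply q p) - (INF y\<in>E. ereal (blinfun_apply y p))"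

definition legendre_fenchel ::
  "(('a::real_normed_vector \<Rightarrow>\<^sub>L real) \<Rightarrow> ereal) \<Rightarrow> 'a \<Rightarrow> ereal" where
  "legendre_fenchel f x = (SUP q. ereal (blinfun_apply q x) - f q)"

text \<open>The space of continuous real functions with uniform convergence on compact sets.\<close>

definition ucc_open :: "('a::topological_space \<Rightarrow> real) set \<Rightarrow> bool" where
  "ucc_open U \<longleftrightarrow> U \<subseteq> {f. continuous_on UNIV f} \<and>
     (\<forall>f\<in>U. \<exists>K e. compact K \<and> 0 < e \<and>
        {g. continuous_on UNIV g \<and> (\<forall>x\<in>K. dist (g x) (f x) < e)} \<subseteq> U)"

definition ucc_topology :: "('a::topological_space \<Rightarrow> real) topology" where
  "ucc_topology = topology ucc_open"

lemma openin_ucc_topology: "openin ucc_topology = ucc_open"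
proof -
  let ?N = "\<lambda>f K e. {g::'a \<Rightarrow> real. continuous_on UNIV g \<and> (\<forall>x\<in>K. dist (g x) (f x) < e)}"
  have "ucc_open (S \<inter> T)" if S: "ucc_open S" and T: "ucc_open T" for S T :: "('a \<Rightarrow> real) set"
    unfolding ucc_open_def
  proof (intro conjI ballI)
    show "S \<inter> T \<subseteq> {f. continuous_on UNIV f}" using S unfolding ucc_open_def by blast
    fix f assume f: "f \<in> S \<inter> T"
    then have "f \<in> S" "f \<in> T" by auto
    obtain K e where 1: "compact K" "0 < e" "?N f K e \<subseteq> S"
      using S \<open>f \<in> S\<close> unfolding ucc_open_def by meson
    obtain L d where 2: "compact L" "0 < d" "?N f L d \<subseteq> T"
      using T \<open>f \<in> T\<close> unfolding ucc_open_def by meson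
    have "?N f (K \<union> L) (min e d) \<subseteq> ?N f K e" "?N f (K \<union> L) (min e d) \<subseteq> ?N f L d" by auto
    then have "?N f (K \<union> L) (min e d) \<subseteq> S \<inter> T" using 1(3) 2(3) by (meson Int_greatest order_trans)
    moreover have "compact (K \<union> L)" "0 < min e d" using 1 2 by (auto intro: compact_Un)
    ultimately show "\<exists>K e. compact K \<and> 0 < e \<and> ?N f K e \<subseteq> S \<inter> T" by meson
  qed
  moreover have "ucc_open (\<Union>\<K>)" if K: "\<forall>S\<in>\<K>. ucc_open S" for \<K> :: "('a \<Rightarrow> real) set set"
    unfolding ucc_open_def
  proof (intro conjI ballI)
    show "\<Union>\<K> \<subseteq> {f. continuous_on UNIV f}" using K unfolding ucc_open_def by (meson Sup_least)
    fix f assume "f \<in> \<Union>\<K>"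
    then obtain S where S: "S \<in> \<K>" "f \<in> S" by (rule UnionE)
    then obtain L d where L: "compact L" "0 < d" "?N f L d \<subseteq> S"
      using K unfolding ucc_open_def by meson
    have "?N f L d \<subseteq> \<Union>\<K>" using L(3) Union_upper[OF S(1)] by (rule order_trans)
    then show "\<exists>K e. compact K \<and> 0 < e \<and> ?N f K e \<subseteq> \<Union>\<K>" using L by meson
  qed
  ultimately have "istopology (ucc_open :: ('a \<Rightarrow> real) set \<Rightarrow> bool)"
    unfolding istopology_def by simp
  then show ?thesis unfolding ucc_topology_def by (rule topology_inverse')
qed

lemma topspace_ucc_topology: "topspace ucc_topology = {f. continuous_on UNIV f}"
proof
  show "topspace ucc_topology \<subseteq> {f::'a \<Rightarrow> real. continuous_on UNIV f}"
    using openin_topspace[of "ucc_topology :: ('a \<Rightarrow> real) topology"]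
    unfolding openin_ucc_topology ucc_open_def by (rule conjunct1)
  have "ucc_open {f::'a \<Rightarrow> real. continuous_on UNIV f}"
    unfolding ucc_open_def by (auto intro!: exI[of _ "{}"] exI[of _ "1::real"])
  then show "{f::'a \<Rightarrow> real. continuous_on UNIV f} \<subseteq> topspace ucc_topology"
    by (intro openin_subset) (simp add: openin_ucc_topology)
qed

definition horo_dist :: "'a::real_normed_vector \<Rightarrow> 'a \<Rightarrow> real" where
  "horo_dist z x = norm (z - x) - norm z"

definition horofunctions :: "('a::real_normed_vector \<Rightarrow> real) set" where
  "horofunctions = ucc_topology closure_of (range horo_dist) - range horo_dist"

text \<open>The values of \<open>\<gamma>\<close> outside \<open>T\<close> play no role.\<close>

definition almost_geodesic :: "real set \<Rightarrow> (real \<Rightarrow> 'a::metric_space) \<Rightarrow> bool" where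
  "almost_geodesic T \<gamma> \<longleftrightarrow>
     T \<subseteq> {0..} \<and> \<not> bounded T \<and> 0 \<in> T \<and>
     (\<forall>e>0. \<exists>M. \<forall>s\<in>T. \<forall>t\<in>T. M \<le> s \<and> s \<le> t \<longrightarrow>
        \<bar>dist (\<gamma> t) (\<gamma> s) + dist (\<gamma> s) (\<gamma> 0) - t\<bar> < e)"

definition busemann_points :: "('a::real_normed_vector \<Rightarrow> real) set" where
  "busemann_points = {h \<in> horofunctions. \<exists>T \<gamma>. almost_geodesic T \<gamma> \<and>
     (\<forall>K. compact K \<longrightarrow>
        uniform_limit K (\<lambda>t. horo_dist (\<gamma> t)) h (inf at_top (principal T)))}"

end

theory Submission
  imports Defs
begin

text \<open>
  Write \<open>\<sigma>\<^sub>E v\<close> for the supremum of \<open>q v\<close> over \<open>q \<in> E\<close>; for the dual ball this is the norm. The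
  transform of \<open>f\<close> for the pair \<open>E, p\<close> is \<open>x \<mapsto> \<sigma>\<^sub>E (x - p) - \<sigma>\<^sub>E (- p)\<close>, and \<open>\<phi>\<^sub>z\<close> is the same
  expression with \<open>E\<close> the dual ball and \<open>p = z\<close>. So the theorem says which parts \<open>E\<close> of the dual
  ball survive when \<open>z\<close> runs to infinity along an almost-geodesic.

  A Busemann point comes from a proper face. Along an almost-geodesic, put \<open>w t = \<gamma> t - \<gamma> 0\<close> and
  \<open>g\<^sub>t q = q (w t) + \<parallel>w t\<parallel>\<close> on the dual ball. These functions are affine and nonnegative, and the
  almost-geodesic inequality says that they increase in \<open>t\<close> up to an arbitrarily small
  error. So they converge pointwise to an affine function with values in \<open>[0, \<infinity>]\<close>. The set \<open>E\<close> where
  the limit is finite is a face, because a convex combination of two nonnegative numbers bounds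
  each of them. On \<open>E\<close> the limit is affine, that is \<open>q \<mapsto> q p + c\<close> for some \<open>p\<close>, and by
  compactness of the dual ball the conjugate functions converge as well, which gives
  \<open>\<sigma>\<^sub>E (x - p) - c\<close> (\<open>limit_of_almost_increasing_affine_functions\<close>). If \<open>E\<close> were the whole dual
  ball, the limit would be \<open>\<phi>\<^sub>p\<close>, which is no horofunction.

  A proper face gives a Busemann point. Let \<open>h x = \<sigma>\<^sub>E (x - p) - \<sigma>\<^sub>E (- p)\<close>. It is enough to find,
  for finitely many points \<open>x\<close> and \<open>\<epsilon> > 0\<close>, arbitrarily long vectors \<open>z\<close> with \<open>\<phi>\<^sub>z x\<close> within
  \<open>\<epsilon>\<close> of \<open>h x\<close> and with \<open>\<parallel>z\<parallel> + h z \<le> \<epsilon>\<close>: choosing such \<open>z\<^sub>n\<close> recursively, with the earlier ones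
  among the test points, makes \<open>\<parallel>z\<^sub>n - z\<^sub>m\<parallel> + \<parallel>z\<^sub>m\<parallel> - \<parallel>z\<^sub>n\<parallel> = \<phi>\<^sub>z x + \<parallel>x\<parallel>\<close> (at \<open>z = z\<^sub>n\<close>,
  \<open>x = z\<^sub>m\<close>) small, so that the sequence, parametrised by its norms, is an almost-geodesic. One takes
  \<open>z = p - r\<close>, where \<open>r\<close> has a constant value \<open>c\<close> on \<open>E\<close> and \<open>\<parallel>x + r\<parallel> - c\<close> is within \<open>\<epsilon>\<close> of
  \<open>\<sigma>\<^sub>E x\<close> for the prescribed \<open>x\<close>. Such an \<open>r\<close> exists by duality
  (\<open>norm_approximates_support_of_face\<close>): the infimum of the sum of the \<open>\<parallel>x + r\<parallel> - c\<close> over all \<open>r\<close>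
  that are constant on \<open>E\<close> is matched on the dual side by functionals \<open>q\<^sub>x\<close> in the dual ball whose
  mean lies in the affine hull of \<open>E\<close>. A face is the intersection of its affine hull with the
  dual ball, so the mean lies in \<open>E\<close>, and as \<open>E\<close> is a face every \<open>q\<^sub>x\<close> lies in \<open>E\<close>.

  A finite-dimensional normed space need not be of class \<open>euclidean_space\<close>. Therefore the
  finite spanning set \<open>S\<close> appears as a hypothesis, and the tools used (Hahn-Banach separation,
  pointwise compactness of the dual ball, the dual of the dual) are derived from it.
\<close>

section \<open>Sublinear functions and the Hahn-Banach theorem\<close>

text \<open>
  Homogeneity is required only for positive factors, which is what infima satisfy without further
  work; the value at the origin follows.
\<close>
definition sublinear :: "('a::real_vector \<Rightarrow> real) \<Rightarrow> bool" where
  "sublinear p \<longleftrightarrow> (\<forall>x y. p (x + y) \<le> p x + p y) \<and> (\<forall>c>0. \<forall>x. p (c *\<^sub>R x) = c * p x)"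

lemma sublinear_zero: "sublinear p \<Longrightarrow> p 0 = 0"
  unfolding sublinear_def
proof (elim conjE)
  assume "\<forall>c>0. \<forall>x. p (c *\<^sub>R x) = c * p x"
  then have "p (2 *\<^sub>R 0) = 2 * p 0" by (metis zero_less_numeral)
  then show ?thesis by simp
qed

lemma sublinear_norm: "sublinear norm"
  unfolding sublinear_def by (auto intro: norm_triangle_ineq)

lemma sublinear_add: "sublinear p \<Longrightarrow> p (x + y) \<le> p x + p y"
  by (simp add: sublinear_def)

lemma sublinear_scale: "sublinear p \<Longrightarrow> 0 \<le> c \<Longrightarrow> p (c *\<^sub>R x) = c * p x"
  by (cases "c = 0") (auto simp: sublinear_zero sublinear_def)

text \<open>
  For an infimum over several parameters, \<open>A x\<close> can be taken to be the set of all numbers above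
  some value; additivity and homogeneity then become closure properties of these sets.
\<close>
lemma sublinear_Inf:
  fixes A :: "'a::real_vector \<Rightarrow> real set"
  assumes ne: "\<And>x. A x \<noteq> {}" and bdd: "\<And>x. bdd_below (A x)"
    and add: "\<And>x y a b. a \<in> A x \<Longrightarrow> b \<in> A y \<Longrightarrow> a + b \<in> A (x + y)"
    and scale: "\<And>x a c. a \<in> A x \<Longrightarrow> 0 < c \<Longrightarrow> c * a \<in> A (c *\<^sub>R x)"
  shows "sublinear (\<lambda>x. Inf (A x))"
  unfolding sublinear_def
proof (intro conjI allI impI)
  fix x y
  have "Inf (A (x + y)) - b \<le> Inf (A x)" if b: "b \<in> A y" for b
    by (rule cInf_greatest[OF ne]) (use cInf_lower[OF add[OF _ b] bdd] in \<open>simp add: algebra_simps\<close>)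
  then have "Inf (A (x + y)) - Inf (A x) \<le> b" if "b \<in> A y" for b
    using that by (smt (verit))
  then have "Inf (A (x + y)) - Inf (A x) \<le> Inf (A y)" by (rule cInf_greatest[OF ne])
  then show "Inf (A (x + y)) \<le> Inf (A x) + Inf (A y)" by simp
next
  have le: "Inf (A (c *\<^sub>R x)) \<le> c * Inf (A x)" if c: "0 < c" for c x
  proof -
    have "Inf (A (c *\<^sub>R x)) / c \<le> Inf (A x)"
      by (rule cInf_greatest[OF ne])
        (use cInf_lower[OF scale[OF _ c] bdd] c in \<open>simp add: field_simps\<close>)
    then show ?thesis using c by (simp add: field_simps)
  qed
  fix c :: real and x assume c: "0 < c"
  have "Inf (A x) \<le> inverse c * Inf (A (c *\<^sub>R x))"
    using le[of "inverse c" "c *\<^sub>R x"] c by simp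
  then have "c * Inf (A x) \<le> Inf (A (c *\<^sub>R x))" using c by (simp add: field_simps)
  with le[OF c, of x] show "Inf (A (c *\<^sub>R x)) = c * Inf (A x)" by simp
qed

text \<open>
  The function \<open>p\<close> is the largest sublinear one below \<open>\<tau>\<close> with \<open>p (- r) \<le> \<Psi> r\<close> on \<open>D\<close>, namely
  \<open>p x = inf (\<tau> (x + t r) + t \<Psi> r)\<close> over \<open>t \<ge> 0\<close> and \<open>r \<in> D\<close>. The hypothesis on the sum keeps the
  infimum finite; convexity of \<open>\<Psi>\<close> makes it subadditive.
\<close>
lemma sublinear_relax:
  fixes \<tau> :: "'a::real_vector \<Rightarrow> real"
  assumes \<tau>: "sublinear \<tau>" and \<Psi>: "convex_on D \<Psi>" and D: "D \<noteq> {}"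
    and nonneg: "\<And>r. r \<in> D \<Longrightarrow> 0 \<le> \<tau> r + \<Psi> r"
  obtains p where "sublinear p" "\<And>x. p x \<le> \<tau> x" "\<And>r. r \<in> D \<Longrightarrow> p (- r) \<le> \<Psi> r"
proof -
  define A where "A = (\<lambda>x. {a. \<exists>t\<ge>0. \<exists>r\<in>D. \<tau> (x + t *\<^sub>R r) + t * \<Psi> r \<le> a})"
  have bdd: "bdd_below (A x)" for x
  proof (rule bdd_belowI)
    fix a assume "a \<in> A x"
    then obtain t r where t: "0 \<le> t" and r: "r \<in> D" and a: "\<tau> (x + t *\<^sub>R r) + t * \<Psi> r \<le> a"
      by (auto simp: A_def)
    have "t * \<tau> r = \<tau> ((x + t *\<^sub>R r) + - x)" using sublinear_scale[OF \<tau> t, of r] by simp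
    also have "\<dots> \<le> \<tau> (x + t *\<^sub>R r) + \<tau> (- x)" by (rule sublinear_add[OF \<tau>])
    finally have "t * (\<tau> r + \<Psi> r) - \<tau> (- x) \<le> a" using a by (simp add: algebra_simps)
    moreover have "0 \<le> t * (\<tau> r + \<Psi> r)" using t nonneg[OF r] by simp
    ultimately show "- \<tau> (- x) \<le> a" by simp
  qed
  have "sublinear (\<lambda>x. Inf (A x))"
  proof (rule sublinear_Inf[OF _ bdd])
    show "A x \<noteq> {}" for x using D by (force simp: A_def)
  next
    fix x y a b assume "a \<in> A x" "b \<in> A y"
    then obtain t r s r' where t: "0 \<le> t" "r \<in> D" and a: "\<tau> (x + t *\<^sub>R r) + t * \<Psi> r \<le> a"
      and s: "0 \<le> s" "r' \<in> D" and b: "\<tau> (y + s *\<^sub>R r') + s * \<Psi> r' \<le> b"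
      by (auto simp: A_def)
    have "\<tau> ((x + t *\<^sub>R r) + (y + s *\<^sub>R r')) \<le> \<tau> (x + t *\<^sub>R r) + \<tau> (y + s *\<^sub>R r')"
      by (rule sublinear_add[OF \<tau>])
    then have ab: "\<tau> ((x + y) + (t *\<^sub>R r + s *\<^sub>R r')) + (t * \<Psi> r + s * \<Psi> r') \<le> a + b"
      using a b by (simp add: algebra_simps)
    show "a + b \<in> A (x + y)"
    proof (cases "t + s = 0")
      case True
      then have "t = 0" "s = 0" using t s by auto
      then show ?thesis using ab t by (force simp: A_def)
    next
      case False
      define u where "u = t / (t + s)"
      define r'' where "r'' = u *\<^sub>R r + (1 - u) *\<^sub>R r'"
      have u: "0 \<le> u" "0 \<le> 1 - u" using t s False by (auto simp: u_def field_simps)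
      have us: "(t + s) * u = t" "(t + s) * (1 - u) = s"
        using False by (auto simp: u_def field_simps)
      have r'': "r'' \<in> D" "\<Psi> r'' \<le> u * \<Psi> r + (1 - u) * \<Psi> r'"
        using \<Psi> t s u unfolding convex_on_def convex_def r''_def by auto
      have "(t + s) *\<^sub>R r'' = t *\<^sub>R r + s *\<^sub>R r'"
        unfolding r''_def scaleR_add_right scaleR_scaleR us ..
      moreover have "(t + s) * \<Psi> r'' \<le> (t + s) * (u * \<Psi> r + (1 - u) * \<Psi> r')"
        using r''(2) t s by (intro mult_left_mono) auto
      then have "(t + s) * \<Psi> r'' \<le> t * \<Psi> r + s * \<Psi> r'"
        unfolding distrib_left mult.assoc[symmetric] us .
      ultimately have "\<tau> ((x + y) + (t + s) *\<^sub>R r'') + (t + s) * \<Psi> r'' \<le> a + b"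
        using ab by simp
      moreover have "0 \<le> t + s" using t s by simp
      ultimately show ?thesis using r''(1) unfolding A_def by blast
    qed
  next
    fix x a and c :: real assume "a \<in> A x" and c: "0 < c"
    then obtain t r where t: "0 \<le> t" "r \<in> D" and a: "\<tau> (x + t *\<^sub>R r) + t * \<Psi> r \<le> a"
      by (auto simp: A_def)
    have "\<tau> (c *\<^sub>R x + (c * t) *\<^sub>R r) = \<tau> (c *\<^sub>R (x + t *\<^sub>R r))" by (simp add: algebra_simps)
    also have "\<dots> = c * \<tau> (x + t *\<^sub>R r)" using \<tau> c by (simp add: sublinear_scale)
    finally have "\<tau> (c *\<^sub>R x + (c * t) *\<^sub>R r) + (c * t) * \<Psi> r = c * (\<tau> (x + t *\<^sub>R r) + t * \<Psi> r)"
      by (simp add: algebra_simps)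
    also have "\<dots> \<le> c * a" using a c by simp
    finally show "c * a \<in> A (c *\<^sub>R x)"
      unfolding A_def using t c by (auto intro!: exI[of _ "c * t"])
  qed
  moreover have "Inf (A x) \<le> \<tau> x" for x
    using D by (intro cInf_lower[OF _ bdd]) (force simp: A_def)
  moreover have "Inf (A (- r)) \<le> \<Psi> r" if "r \<in> D" for r
  proof (rule cInf_lower[OF _ bdd])
    have "\<tau> (- r + 1 *\<^sub>R r) + 1 * \<Psi> r \<le> \<Psi> r" using sublinear_zero[OF \<tau>] by simp
    then show "\<Psi> r \<in> A (- r)" unfolding A_def using that by (blast intro: zero_le_one)
  qed
  ultimately show ?thesis using that by blast
qed

text \<open>
  Hahn-Banach without Zorn's lemma. Relaxing \<open>p\<close> with \<open>D = {b}\<close> and \<open>\<Psi> b = - p b\<close> makes it odd in the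
  direction \<open>b\<close>, and lowering it further keeps it so. Treating the elements of \<open>S\<close> one after the
  other ends with an odd sublinear function, which is linear.
\<close>
lemma sublinear_dominates_linear:
  fixes p :: "'a::real_vector \<Rightarrow> real"
  assumes fd: "finite S" "span S = (UNIV :: 'a set)" and p: "sublinear p"
  obtains q where "linear q" "\<And>x. q x \<le> p x"
proof -
  have "\<exists>q. sublinear q \<and> (\<forall>x. q x \<le> p x) \<and> (\<forall>b\<in>S. q b + q (- b) \<le> 0)"
    using fd(1)
  proof induction
    case empty
    then show ?case using p by auto
  next
    case (insert b B)
    then obtain q where q: "sublinear q" "\<And>x. q x \<le> p x" "\<And>b. b \<in> B \<Longrightarrow> q b + q (- b) \<le> 0"
      by auto
    obtain q' where q': "sublinear q'" "\<And>x. q' x \<le> q x" "q' (- b) \<le> - q b"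
      by (rule sublinear_relax[OF q(1), of "{b}" "\<lambda>_. - q b"]) (simp_all add: convex_on_const)
    show ?case
      using q q' by (intro exI[of _ q']) (smt (verit, best) insert_iff)
  qed
  then obtain q where q: "sublinear q" "\<And>x. q x \<le> p x" "\<And>b. b \<in> S \<Longrightarrow> q b + q (- b) \<le> 0"
    by auto
  \<comment> \<open>The directions in which \<open>q\<close> is odd form a subspace, so \<open>q\<close> is odd everywhere.\<close>
  define L where "L = {x. q x + q (- x) \<le> 0}"
  have ge: "0 \<le> q x + q (- x)" for x
    using sublinear_add[OF q(1), of x "- x"] sublinear_zero[OF q(1)] by simp
  have "subspace L"
    unfolding subspace_def
  proof (intro conjI ballI allI)
    show "0 \<in> L" by (simp add: L_def sublinear_zero[OF q(1)])
    fix x assume x: "x \<in> L"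
    show "x + y \<in> L" if "y \<in> L" for y
      using x that sublinear_add[OF q(1), of x y] sublinear_add[OF q(1), of "- x" "- y"]
      by (simp add: L_def)
    fix c :: real
    show "c *\<^sub>R x \<in> L"
    proof (cases "0 \<le> c")
      case True
      then show ?thesis
        using x sublinear_scale[OF q(1) True, of x] sublinear_scale[OF q(1) True, of "- x"]
        by (simp add: L_def flip: distrib_left) (simp add: mult_nonneg_nonpos)
    next
      case False
      then have c: "0 \<le> - c" by simp
      show ?thesis
        using x sublinear_scale[OF q(1) c, of x] sublinear_scale[OF q(1) c, of "- x"] c
        using mult_nonneg_nonpos[OF c, of "q x + q (- x)"]
        by (simp add: L_def algebra_simps)
    qed
  qed
  moreover have "S \<subseteq> L" using q(3) by (auto simp: L_def)
  ultimately have "span S \<subseteq> L" by (rule span_minimal[rotated])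
  then have "x \<in> L" for x using fd(2) by auto
  then have odd: "q (- x) = - q x" for x
    using ge[of x] by (simp add: L_def eq_neg_iff_add_eq_0 add.commute antisym)
  have "linear q"
  proof (rule linearI)
    fix x y and c :: real
    show "q (x + y) = q x + q y"
      using sublinear_add[OF q(1), of x y] sublinear_add[OF q(1), of "- x" "- y"] odd[of "x + y"]
        odd[of x] odd[of y] by simp
    show "q (c *\<^sub>R x) = c *\<^sub>R q x"
    proof (cases "0 \<le> c")
      case False
      then show ?thesis using sublinear_scale[OF q(1), of "- c" x] odd[of "c *\<^sub>R x"] by simp
    qed (simp add: sublinear_scale[OF q(1)])
  qed
  with q(2) show ?thesis using that by blast
qed

text \<open>
  On \<open>D\<close>, a linear functional fits between the concave \<open>- \<Psi>\<close> and the sublinear \<open>\<tau>\<close> above it. This is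
  the form in which Hahn-Banach is applied, both to a single point (norming functionals) and to
  sums of norms.
\<close>
lemma sublinear_convex_sandwich:
  fixes \<tau> :: "'a::real_vector \<Rightarrow> real"
  assumes fd: "finite S" "span S = (UNIV :: 'a set)"
    and \<tau>: "sublinear \<tau>" and \<Psi>: "convex_on D \<Psi>" and D: "D \<noteq> {}"
    and nonneg: "\<And>r. r \<in> D \<Longrightarrow> 0 \<le> \<tau> r + \<Psi> r"
  obtains q where "linear q" "\<And>x. q x \<le> \<tau> x" "\<And>r. r \<in> D \<Longrightarrow> 0 \<le> q r + \<Psi> r"
proof -
  obtain p where p: "sublinear p" "\<And>x. p x \<le> \<tau> x" "\<And>r. r \<in> D \<Longrightarrow> p (- r) \<le> \<Psi> r"
    using sublinear_relax[OF \<tau> \<Psi> D nonneg] by blast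
  obtain q where q: "linear q" "\<And>x. q x \<le> p x"
    using sublinear_dominates_linear[OF fd p(1)] by blast
  have "0 \<le> q r + \<Psi> r" if "r \<in> D" for r
    using q(2)[of "- r"] p(3)[OF that] linear_neg[OF q(1), of r] by simp
  then show ?thesis using that q p(2) by (meson order_trans)
qed

section \<open>The dual ball\<close>

lemma dual_ball_iff: "q \<in> dual_ball \<longleftrightarrow> (\<forall>x. blinfun_apply q x \<le> norm x)"
proof
  assume q: "q \<in> dual_ball"
  show "\<forall>x. blinfun_apply q x \<le> norm x"
  proof
    fix x :: 'a
    show "blinfun_apply q x \<le> norm x"
    proof (cases "x = 0")
      case False
      have "- 1 \<le> blinfun_apply q (- (inverse (norm x)) *\<^sub>R x)"
        using q False by (simp add: dual_ball_def)
      then show ?thesis using False by (simp add: blinfun.scaleR_right blinfun.minus_right field_simps)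
    qed simp
  qed
next
  assume q: "\<forall>x. blinfun_apply q x \<le> norm x"
  show "q \<in> dual_ball"
    unfolding dual_ball_def
  proof (intro CollectI ballI)
    fix x :: 'a assume "x \<in> cball 0 1"
    then show "- 1 \<le> blinfun_apply q x" using q[rule_format, of "- x"] by (simp add: blinfun.minus_right)
  qed
qed

lemma dual_ball_le: "q \<in> dual_ball \<Longrightarrow> blinfun_apply q x \<le> norm x"
  by (simp add: dual_ball_iff)

lemma dual_ball_ge: "q \<in> dual_ball \<Longrightarrow> - norm x \<le> blinfun_apply q x"
  using dual_ball_le[of q "- x"] by (simp add: blinfun.minus_right)

lemma dual_ball_of_linear:
  fixes q :: "'a::real_normed_vector \<Rightarrow> real"
  assumes "linear q" "\<And>x. q x \<le> norm x"
  obtains q' where "q' \<in> dual_ball" "blinfun_apply q' = q"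
proof -
  have "\<bar>q x\<bar> \<le> norm x" for x
    using assms(2)[of x] assms(2)[of "- x"] linear_neg[OF assms(1), of x] by simp
  then have "bounded_linear q"
    using assms(1) by (intro bounded_linear_intro[of q 1]) (auto simp: linear_add linear_scale)
  then have "blinfun_apply (Blinfun q) = q" by (rule bounded_linear_Blinfun_apply)
  then show ?thesis using that[of "Blinfun q"] assms(2) by (simp add: dual_ball_iff)
qed

lemma norming_functional:
  fixes x :: "'a::real_normed_vector"
  assumes fd: "finite S" "span S = (UNIV :: 'a set)"
  obtains q where "q \<in> dual_ball" "blinfun_apply q x = norm x"
proof -
  obtain q where q: "linear q" "\<And>x. q x \<le> norm x" "0 \<le> q x + (- norm x)"
    by (rule sublinear_convex_sandwich[OF fd sublinear_norm, of "{x}" "\<lambda>_. - norm x"])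
       (simp_all add: convex_on_const)
  with dual_ball_of_linear[OF q(1,2)] show ?thesis using that by (metis add.commute add_0 antisym diff_ge_0_iff_ge uminus_add_conv_diff)
qed

text \<open>
  Convergence on the finite set \<open>S\<close> can be arranged by passing to subsequences finitely often, and
  it spreads to the span by linearity. Convergence is meant pointwise, so that no norm on the dual
  space enters.
\<close>
lemma dual_ball_sequentially_compact:
  fixes q :: "nat \<Rightarrow> 'a::real_normed_vector \<Rightarrow>\<^sub>L real"
  assumes fd: "finite S" "span S = (UNIV :: 'a set)" and q: "\<And>n. q n \<in> dual_ball"
  shows "\<exists>\<rho> q'. strict_mono (\<rho> :: nat \<Rightarrow> nat) \<and> q' \<in> dual_ball \<and>
    (\<forall>x. (\<lambda>n. blinfun_apply (q (\<rho> n)) x) \<longlonglongrightarrow> blinfun_apply q' x)"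
proof -
  have "\<exists>\<rho>::nat \<Rightarrow> nat. strict_mono \<rho> \<and> (\<forall>b\<in>S. convergent (\<lambda>n. blinfun_apply (q (\<rho> n)) b))"
    using fd(1)
  proof induction
    case empty
    then show ?case using strict_mono_id by auto
  next
    case (insert b B)
    then obtain \<rho> :: "nat \<Rightarrow> nat" where \<rho>: "strict_mono \<rho>"
      "\<And>b. b \<in> B \<Longrightarrow> convergent (\<lambda>n. blinfun_apply (q (\<rho> n)) b)" by blast
    have "bounded (range (\<lambda>n. blinfun_apply (q (\<rho> n)) b))"
      unfolding bounded_iff using dual_ball_le[OF q] dual_ball_ge[OF q]
      by (auto intro!: exI[of _ "norm b"] simp: abs_le_iff minus_le_iff)
    then obtain l and \<sigma> :: "nat \<Rightarrow> nat" where \<sigma>: "strict_mono \<sigma>"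
      "((\<lambda>n. blinfun_apply (q (\<rho> n)) b) \<circ> \<sigma>) \<longlonglongrightarrow> l"
      using bounded_imp_convergent_subsequence by blast
    have "convergent (\<lambda>n. blinfun_apply (q ((\<rho> \<circ> \<sigma>) n)) b')" if "b' \<in> insert b B" for b'
    proof (cases "b' = b")
      case True
      then show ?thesis using \<sigma>(2) by (auto simp: o_def convergent_def)
    next
      case False
      then show ?thesis
        using convergent_subseq_convergent[OF \<rho>(2) \<sigma>(1), of b'] that by (simp add: o_def)
    qed
    then show ?case using strict_mono_o[OF \<rho>(1) \<sigma>(1)] by blast
  qed
  then obtain \<rho> :: "nat \<Rightarrow> nat" where \<rho>: "strict_mono \<rho>"
    "\<And>b. b \<in> S \<Longrightarrow> convergent (\<lambda>n. blinfun_apply (q (\<rho> n)) b)" by blast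
  define C where "C = {x. convergent (\<lambda>n. blinfun_apply (q (\<rho> n)) x)}"
  have "subspace C"
    unfolding C_def subspace_def
    by (auto simp: blinfun.add_right blinfun.scaleR_right convergent_const
        intro: convergent_add convergent_mult)
  then have "span S \<subseteq> C" using \<rho>(2) by (intro span_minimal) (auto simp: C_def)
  then have "convergent (\<lambda>n. blinfun_apply (q (\<rho> n)) x)" for x using fd(2) by (auto simp: C_def)
  then obtain g where g: "\<And>x. (\<lambda>n. blinfun_apply (q (\<rho> n)) x) \<longlonglongrightarrow> g x"
    unfolding convergent_def by metis
  have "linear g"
  proof (rule linearI)
    fix x y and c :: real
    show "g (x + y) = g x + g y"
      by (rule LIMSEQ_unique[OF g]) (use tendsto_add[OF g g] in \<open>simp add: blinfun.add_right\<close>)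
    show "g (c *\<^sub>R x) = c *\<^sub>R g x"
      by (rule LIMSEQ_unique[OF g]) (use tendsto_mult[OF tendsto_const g] in \<open>simp add: blinfun.scaleR_right\<close>)
  qed
  moreover have "g x \<le> norm x" for x
    by (rule LIMSEQ_le_const2[OF g]) (use dual_ball_le[OF q] in blast)
  ultimately obtain q' where "q' \<in> dual_ball" "blinfun_apply q' = g"
    using dual_ball_of_linear by blast
  then show ?thesis using \<rho>(1) g by (intro exI[of _ \<rho>] exI[of _ q']) simp
qed

section \<open>Evaluations are the only functionals on the dual\<close>

text \<open>
  A functional that vanishes on the common kernel of finitely many functionals is a combination
  of them. Inductively, the coefficients found on the kernel of \<open>f a\<close> leave a remainder that
  vanishes there, so the remainder is a multiple of \<open>f a\<close>.
\<close>
lemma functional_combination_of_kernels: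
  fixes f :: "'b \<Rightarrow> 'w::real_vector \<Rightarrow> real"
  assumes "finite B" "subspace U" "\<And>b. b \<in> B \<Longrightarrow> linear (f b)"
    and "\<And>u v c. u \<in> U \<Longrightarrow> v \<in> U \<Longrightarrow> L (u + c *\<^sub>R v) = L u + c * L v"
    and "\<And>u. u \<in> U \<Longrightarrow> \<forall>b\<in>B. f b u = 0 \<Longrightarrow> L u = 0"
  shows "\<exists>c. \<forall>u\<in>U. L u = (\<Sum>b\<in>B. c b * f b u)"
  using assms
proof (induction B arbitrary: U)
  case empty
  then show ?case by simp
next
  case (insert a B)
  note U = insert(4) and f = insert(5) and L = insert(6)
  have fa: "linear (f a)" by (simp add: f)
  define U' where "U' = {u \<in> U. f a u = 0}"
  have "subspace U'"
    unfolding U'_def subspace_def using U fa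
    by (auto simp: subspace_0 subspace_add subspace_scale linear_0 linear_add linear_scale)
  then have "\<exists>c. \<forall>u\<in>U'. L u = (\<Sum>b\<in>B. c b * f b u)"
    by (rule insert(3)) (use insert(5-7) in \<open>auto simp: U'_def\<close>)
  then obtain c where c: "\<And>u. u \<in> U' \<Longrightarrow> L u = (\<Sum>b\<in>B. c b * f b u)" by blast
  have sum_upd: "(\<Sum>b\<in>insert a B. (c(a := k)) b * f b u) = k * f a u + (\<Sum>b\<in>B. c b * f b u)" for k u
    using insert(1,2) by (auto intro!: sum.cong)
  show ?case
  proof (cases "\<exists>u0\<in>U. f a u0 \<noteq> 0")
    case True
    then obtain u0 where u0: "u0 \<in> U" "f a u0 \<noteq> 0" by blast
    define k where "k = (L u0 - (\<Sum>b\<in>B. c b * f b u0)) / f a u0"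
    have "L u = k * f a u + (\<Sum>b\<in>B. c b * f b u)" if u: "u \<in> U" for u
    proof -
      define s where "s = f a u / f a u0"
      have "f a (u + (- s) *\<^sub>R u0) = 0"
        using u0(2) by (simp add: s_def linear_add[OF fa] linear_scale[OF fa] linear_diff[OF fa])
      moreover have "u + (- s) *\<^sub>R u0 \<in> U" using U u u0(1) by (intro subspace_add subspace_scale)
      ultimately have "L (u + (- s) *\<^sub>R u0) = (\<Sum>b\<in>B. c b * f b (u + (- s) *\<^sub>R u0))"
        by (intro c) (simp add: U'_def)
      also have "\<dots> = (\<Sum>b\<in>B. c b * f b u - s * (c b * f b u0))"
        using f by (intro sum.cong) (simp_all add: linear_diff linear_scale algebra_simps)
      also have "\<dots> = (\<Sum>b\<in>B. c b * f b u) - s * (\<Sum>b\<in>B. c b * f b u0)"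
        by (simp add: sum_subtractf sum_distrib_left)
      finally have "L u = (\<Sum>b\<in>B. c b * f b u) + s * (L u0 - (\<Sum>b\<in>B. c b * f b u0))"
        unfolding L[OF u u0(1)] by (simp add: algebra_simps)
      then show ?thesis by (simp add: s_def k_def)
    qed
    then show ?thesis by (metis sum_upd)
  next
    case False
    then have "L u = 0 * f a u + (\<Sum>b\<in>B. c b * f b u)" if "u \<in> U" for u
      using c that by (simp add: U'_def)
    then show ?thesis by (metis sum_upd)
  qed
qed

text \<open>
  An element of the dual space that vanishes on \<open>S\<close> is zero, so evaluations at the points of
  \<open>S\<close> have trivial common kernel. A subspace \<open>U\<close> is allowed because the functional of interest
  will be a limit that exists only on part of the dual space.
\<close>
lemma dual_functional_is_evaluation:
  fixes L :: "('a::real_normed_vector \<Rightarrow>\<^sub>L real) \<Rightarrow> real"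
  assumes fd: "finite S" "span S = (UNIV :: 'a set)" and U: "subspace U"
    and L: "\<And>u v c. u \<in> U \<Longrightarrow> v \<in> U \<Longrightarrow> L (u + c *\<^sub>R v) = L u + c * L v"
  obtains v where "\<And>u. u \<in> U \<Longrightarrow> L u = blinfun_apply u v"
proof -
  have "L 0 = L (0 + 1 *\<^sub>R 0)" by simp
  also have "\<dots> = L 0 + 1 * L 0" by (intro L subspace_0[OF U])
  finally have L0: "L 0 = 0" by simp
  have "\<exists>c. \<forall>u\<in>U. L u = (\<Sum>b\<in>S. c b * blinfun_apply u b)"
  proof (rule functional_combination_of_kernels[OF fd(1) U])
    show "linear (\<lambda>u. blinfun_apply u b)" for b :: 'a
      by (rule linearI) (simp_all add: blinfun.add_left blinfun.scaleR_left)
    fix u :: "'a \<Rightarrow>\<^sub>L real" assume u: "\<forall>b\<in>S. blinfun_apply u b = 0"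
    have "blinfun_apply u x = blinfun_apply 0 x" for x
    proof (rule linear_eq_on_span[of "blinfun_apply u" "blinfun_apply 0" S])
      show "linear (blinfun_apply u)" "linear (blinfun_apply (0 :: 'a \<Rightarrow>\<^sub>L real))"
        by (auto intro: bounded_linear.linear blinfun.bounded_linear_right)
    qed (use u fd in auto)
    then have "u = 0" by (intro blinfun_eqI)
    then show "L u = 0" using L0 by simp
  qed (rule L)
  then obtain c where c: "\<And>u. u \<in> U \<Longrightarrow> L u = (\<Sum>b\<in>S. c b * blinfun_apply u b)" by blast
  show ?thesis
    by (rule that[of "\<Sum>b\<in>S. c b *\<^sub>R b"]) (simp add: c blinfun.sum_right blinfun.scaleR_right)
qed

section \<open>Support functions\<close>

definition support :: "('a::real_normed_vector \<Rightarrow>\<^sub>L real) set \<Rightarrow> 'a \<Rightarrow> real" where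
  "support E v = (SUP q\<in>E. blinfun_apply q v)"

lemma support_upper:
  assumes "E \<subseteq> dual_ball" "q \<in> E"
  shows "blinfun_apply q v \<le> support E v"
  unfolding support_def
  using assms by (intro cSUP_upper) (auto intro!: bdd_aboveI2[of _ _ "norm v"] dual_ball_le)

lemma support_least:
  assumes "E \<noteq> {}" "\<And>q. q \<in> E \<Longrightarrow> blinfun_apply q v \<le> c"
  shows "support E v \<le> c"
  unfolding support_def using assms by (intro cSUP_least)

lemma support_lipschitz:
  assumes E: "E \<subseteq> dual_ball" "E \<noteq> {}"
  shows "support E x \<le> support E y + norm (x - y)"
proof (rule support_least[OF E(2)])
  fix q assume q: "q \<in> E"
  then have "blinfun_apply q (x - y) \<le> norm (x - y)" using E by (auto intro: dual_ball_le)
  then show "blinfun_apply q x \<le> support E y + norm (x - y)"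
    using support_upper[OF E(1) q, of y] by (simp add: blinfun.diff_right)
qed

lemma support_le_norm:
  assumes "E \<subseteq> dual_ball" "E \<noteq> {}"
  shows "support E x \<le> norm x"
  using assms by (intro support_least) (auto intro: dual_ball_le)

lemma support_scale_le:
  assumes E: "E \<subseteq> dual_ball" "E \<noteq> {}" and "0 \<le> c"
  shows "support E (c *\<^sub>R x) \<le> c * support E x"
  using support_upper[OF E(1)] assms
  by (intro support_least) (auto simp: blinfun.scaleR_right intro: mult_left_mono)

text \<open>
  Vectors on which all elements of \<open>E\<close> agree act on the support function like constants; they are
  the directions in which one may move to infinity without changing \<open>\<sigma>\<^sub>E\<close> essentially.
\<close>
lemma support_add_constant:
  assumes E: "E \<subseteq> dual_ball" "E \<noteq> {}" and r: "\<And>e. e \<in> E \<Longrightarrow> blinfun_apply e r = c"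
  shows "support E (x + r) = support E x + c"
proof (rule antisym)
  show "support E (x + r) \<le> support E x + c"
    using support_upper[OF E(1)] r by (intro support_least[OF E(2)]) (simp add: blinfun.add_right)
  have "support E x \<le> support E (x + r) - c"
  proof (rule support_least[OF E(2)])
    fix q assume q: "q \<in> E"
    show "blinfun_apply q x \<le> support E (x + r) - c"
      using support_upper[OF E(1) q, of "x + r"] r[OF q] by (simp add: blinfun.add_right)
  qed
  then show "support E x + c \<le> support E (x + r)" by simp
qed

lemma support_dual_ball:
  fixes x :: "'a::real_normed_vector"
  assumes fd: "finite S" "span S = (UNIV :: 'a set)"
  shows "support dual_ball x = norm x"
proof -
  obtain q where "q \<in> dual_ball" "blinfun_apply q x = norm x" using norming_functional[OF fd] .
  then show ?thesis
    using support_upper[of dual_ball q x] support_le_norm[of dual_ball x] by force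
qed

section \<open>Faces of the dual ball\<close>

text \<open>
  Allowing \<open>t = 0\<close> and \<open>a = b\<close>, which open segments exclude, saves case distinctions below.
\<close>
lemma face_of_combination:
  assumes T: "T face_of C" and a: "a \<in> C" and b: "b \<in> C" and s: "0 < s" "0 \<le> t" "s + t = 1"
    and mem: "s *\<^sub>R a + t *\<^sub>R b \<in> T"
  shows "a \<in> T"
proof (cases "t = 0 \<or> a = b")
  case True
  then show ?thesis using mem s by (auto simp flip: scaleR_add_left)
next
  case False
  have "s *\<^sub>R a + t *\<^sub>R b = (1 - t) *\<^sub>R a + t *\<^sub>R b" using s by (simp add: eq_diff_eq[symmetric])
  then have "s *\<^sub>R a + t *\<^sub>R b \<in> open_segment a b"
    using False s unfolding in_segment by (intro conjI exI[of _ t]) auto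
  then show ?thesis using T a b mem unfolding face_of_def by blast
qed

text \<open>
  The hypothesis \<open>ann\<close> says that \<open>q - e0\<close> is annihilated by everything that annihilates the
  differences of elements of \<open>E\<close>. These differences span \<open>M = {s (e - e') | s \<ge> 0}\<close>, which is a
  subspace since \<open>E\<close> is convex; as functionals on the dual space are evaluations, \<open>q - e0\<close> lies in
  \<open>M\<close>. So \<open>q + s e' = e0 + s e\<close>, and after division by \<open>1 + s\<close> a convex combination of \<open>q\<close> and \<open>e'\<close>
  lies in the face \<open>E\<close>.
\<close>
lemma dual_ball_affine_hull_face:
  fixes E :: "('a::real_normed_vector \<Rightarrow>\<^sub>L real) set"
  assumes fd: "finite S" "span S = (UNIV :: 'a set)"
    and face: "E face_of dual_ball" and e0: "e0 \<in> E" and q: "q \<in> dual_ball"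
    and ann: "\<And>r. (\<And>e. e \<in> E \<Longrightarrow> blinfun_apply e r = blinfun_apply e0 r) \<Longrightarrow>
      blinfun_apply q r = blinfun_apply e0 r"
  shows "q \<in> E"
proof -
  have conv: "convex E" and sub: "E \<subseteq> dual_ball" using face by (auto simp: face_of_def)
  define M where "M = {s *\<^sub>R (e - e') |s e e'. 0 \<le> s \<and> e \<in> E \<and> e' \<in> E}"
  have "subspace M"
    unfolding subspace_def
  proof (intro conjI ballI allI)
    have "0 = 0 *\<^sub>R (e0 - e0)" by simp
    then show "0 \<in> M" unfolding M_def using e0 by blast
    fix x assume "x \<in> M"
    then obtain s e e' where s: "0 \<le> s" "e \<in> E" "e' \<in> E" and x: "x = s *\<^sub>R (e - e')"
      by (auto simp: M_def)
    show "c *\<^sub>R x \<in> M" for c :: real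
    proof (cases "0 \<le> c")
      case True
      have "c *\<^sub>R x = (c * s) *\<^sub>R (e - e')" by (simp add: x)
      moreover have "0 \<le> c * s" using True s by simp
      ultimately show ?thesis unfolding M_def using s by blast
    next
      case False
      have "c *\<^sub>R x = (- c * s) *\<^sub>R (e' - e)" by (simp add: x algebra_simps)
      moreover have "0 \<le> - c * s" using False s by (simp add: mult_nonpos_nonneg)
      ultimately show ?thesis unfolding M_def using s by blast
    qed
    fix y assume "y \<in> M"
    then obtain t f f' where t: "0 \<le> t" "f \<in> E" "f' \<in> E" and y: "y = t *\<^sub>R (f - f')"
      by (auto simp: M_def)
    show "x + y \<in> M"
    proof (cases "s + t = 0")
      case True
      then have "x + y = 0" using s t by (auto simp: x y add_nonneg_eq_0_iff)
      then show ?thesis using \<open>0 \<in> M\<close> by simp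
    next
      case False
      have comb: "(s / (s + t)) *\<^sub>R a + (t / (s + t)) *\<^sub>R b \<in> E" if "a \<in> E" "b \<in> E" for a b
        using conv that s t False by (intro convexD) (auto simp flip: add_divide_distrib)
      have "x + y = (s + t) *\<^sub>R (((s / (s + t)) *\<^sub>R e + (t / (s + t)) *\<^sub>R f)
          - ((s / (s + t)) *\<^sub>R e' + (t / (s + t)) *\<^sub>R f'))"
        using False by (simp add: x y scaleR_diff_right scaleR_add_right)
      moreover have "0 \<le> s + t" using s t by simp
      ultimately show ?thesis unfolding M_def using comb s t by blast
    qed
  qed
  have "q - e0 \<in> M"
  proof (rule ccontr)
    assume nM: "q - e0 \<notin> M"
    obtain B where B: "B \<subseteq> M" "independent B" "M \<subseteq> span B"
      using maximal_independent_subset[of M] by blast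
    have BM: "span B \<subseteq> M" using B(1) \<open>subspace M\<close> by (rule span_minimal)
    then have "independent (insert (q - e0) B)" using nM B(2) by (intro independent_insertI) auto
    then obtain L :: "_ \<Rightarrow> real" where L: "linear L"
      "\<forall>x\<in>insert (q - e0) B. L x = (if x = q - e0 then 1 else 0)"
      using linear_independent_extend[of "insert (q - e0) B" "\<lambda>x. if x = q - e0 then 1 else (0::real)"]
      by blast
    obtain v where v: "\<And>u. L u = blinfun_apply u v"
      using dual_functional_is_evaluation[OF fd subspace_UNIV, of L] L(1)
      by (auto simp: linear_add linear_scale)
    have "L x = 0" if "x \<in> M" for x
    proof (rule linear_eq_0_on_span[OF L(1), of B])
      show "L b = 0" if "b \<in> B" for b
        using L(2) B(1) nM that by auto
      show "x \<in> span B" using B(3) that by blast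
    qed
    moreover have "e - e0 \<in> M" if "e \<in> E" for e
    proof -
      have "e - e0 = 1 *\<^sub>R (e - e0)" by simp
      then show ?thesis unfolding M_def using that e0 zero_le_one by blast
    qed
    ultimately have "blinfun_apply e v = blinfun_apply e0 v" if "e \<in> E" for e
      using v that by (metis blinfun.diff_left eq_iff_diff_eq_0)
    then have "blinfun_apply q v = blinfun_apply e0 v" by (rule ann)
    moreover have "L (q - e0) = 1" using L(2) by simp
    ultimately show False by (simp add: v blinfun.diff_left)
  qed
  then obtain s e e' where s: "0 \<le> s" "e \<in> E" "e' \<in> E" and eq: "q - e0 = s *\<^sub>R (e - e')"
    by (auto simp: M_def)
  have "(1 / (1 + s)) *\<^sub>R q + (s / (1 + s)) *\<^sub>R e' = (1 / (1 + s)) *\<^sub>R e0 + (s / (1 + s)) *\<^sub>R e"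
  proof -
    have "q + s *\<^sub>R e' = e0 + s *\<^sub>R e" using eq by (simp add: algebra_simps)
    then have "(1 / (1 + s)) *\<^sub>R (q + s *\<^sub>R e') = (1 / (1 + s)) *\<^sub>R (e0 + s *\<^sub>R e)" by simp
    then show ?thesis by (simp add: scaleR_add_right)
  qed
  moreover have "(1 / (1 + s)) *\<^sub>R e0 + (s / (1 + s)) *\<^sub>R e \<in> E"
    using conv e0 s by (intro convexD) (auto simp flip: add_divide_distrib)
  ultimately show ?thesis
    using s sub by (intro face_of_combination[OF face q, of e' "1 / (1 + s)" "s / (1 + s)"])
      (auto simp flip: add_divide_distrib)
qed

text \<open>
  A nonnegative support function would place the origin in \<open>E\<close>. But the origin is the midpoint of
  \<open>q\<close> and \<open>- q\<close> for every \<open>q\<close> in the dual ball, so a face that contains it is the whole ball.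
\<close>
lemma support_negative_of_proper_face:
  fixes E :: "('a::real_normed_vector \<Rightarrow>\<^sub>L real) set"
  assumes fd: "finite S" "span S = (UNIV :: 'a set)"
    and face: "E face_of dual_ball" and ne: "E \<noteq> {}" and proper: "E \<noteq> dual_ball"
  obtains v where "support E v < 0"
proof (rule ccontr)
  assume "\<not> thesis"
  then have ge: "0 \<le> support E v" for v using that by (meson not_le)
  have sub: "E \<subseteq> dual_ball" using face by (simp add: face_of_def)
  obtain e0 where e0: "e0 \<in> E" using ne by blast
  have "0 \<in> E"
  proof (rule dual_ball_affine_hull_face[OF fd face e0])
    show "0 \<in> dual_ball" by (simp add: dual_ball_iff)
    fix r assume r: "\<And>e. e \<in> E \<Longrightarrow> blinfun_apply e r = blinfun_apply e0 r"
    have "0 \<le> blinfun_apply e0 r"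
      using ge[of r] support_least[OF ne, of r "blinfun_apply e0 r"] r by force
    moreover have "0 \<le> blinfun_apply e0 (- r)"
      using ge[of "- r"] support_least[OF ne, of "- r" "blinfun_apply e0 (- r)"] r
      by (force simp: blinfun.minus_right)
    ultimately show "blinfun_apply 0 r = blinfun_apply e0 r" by (simp add: blinfun.minus_right)
  qed
  have "q \<in> E" if q: "q \<in> dual_ball" for q
  proof (rule face_of_combination[OF face q, of "- q" "1/2" "1/2"])
    show "- q \<in> dual_ball"
      using dual_ball_ge[OF q] by (simp add: dual_ball_iff blinfun.minus_left) (metis minus_le_iff)
    show "(1 / 2) *\<^sub>R q + (1 / 2) *\<^sub>R - q \<in> E" using \<open>0 \<in> E\<close> by simp
  qed auto
  then show False using proper sub by blast
qed

section \<open>Approximating the support function of a face by norms\<close>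

lemma convex_on_sum_of_norms:
  assumes "finite X" "convex D"
  shows "convex_on D (\<lambda>v. (\<Sum>x\<in>X. norm (x + v)))"
  using assms(1)
proof induction
  case (insert x X)
  have "(\<lambda>v. norm (x + v)) = dist (- x)"
  proof
    show "norm (x + v) = dist (- x) v" for v
      by (metis add.commute add.inverse_inverse diff_minus_eq_add dist_commute dist_norm)
  qed
  then have "convex_on D (\<lambda>v. norm (x + v))" using convex_on_dist[OF assms(2), of "- x"] by simp
  then show ?case using insert by (simp add: convex_on_add)
qed (simp add: convex_on_def assms(2))

text \<open>
  Lagrange duality for minimising a sum of norms over a subspace. Induction on \<open>X\<close> splits one norm
  off with the sandwich theorem: the functional \<open>q\<close> that separates \<open>\<parallel>a + r\<parallel>\<close> from the other
  terms becomes \<open>Q a\<close>, and replacing \<open>\<parallel>a + r\<parallel>\<close> by \<open>q (a + r)\<close> changes \<open>y\<close> to \<open>y - q\<close> and \<open>m\<close> to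
  \<open>m - q a\<close>. For this step the statement is made for all \<open>y\<close> and \<open>m\<close>.
\<close>
lemma sum_norms_lagrange:
  fixes X :: "'a::real_normed_vector set"
  assumes fd: "finite S" "span S = (UNIV :: 'a set)" and U: "subspace U" and X: "finite X"
    and ge: "\<And>r. r \<in> U \<Longrightarrow> m \<le> (\<Sum>x\<in>X. norm (x + r)) - blinfun_apply y r"
  shows "\<exists>Q. (\<forall>x\<in>X. Q x \<in> dual_ball) \<and> (\<forall>r\<in>U. (\<Sum>x\<in>X. blinfun_apply (Q x) r) = blinfun_apply y r) \<and>
             m \<le> (\<Sum>x\<in>X. blinfun_apply (Q x) x)"
  using X ge
proof (induction X arbitrary: y m)
  case empty
  have le: "m \<le> c * blinfun_apply y r" if "r \<in> U" for r c
    using empty[of "- c *\<^sub>R r"] that U by (simp add: subspace_def blinfun.scaleR_right blinfun.minus_right) (metis U subspace_neg subspace_scale)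
  have "blinfun_apply y r = 0" if r: "r \<in> U" for r
  proof (rule ccontr)
    assume n: "blinfun_apply y r \<noteq> 0"
    show False using le[OF r, of "(m - 1) / blinfun_apply y r"] n by simp
  qed
  moreover have "m \<le> 0" using le[of 0 0] U by (simp add: subspace_0)
  ultimately show ?case by auto
next
  case (insert a X)
  \<comment> \<open>With \<open>v = a + r\<close>, the hypothesis reads \<open>0 \<le> norm v + \<Psi> v\<close>.\<close>
  define \<Psi> where "\<Psi> v = (\<Sum>x\<in>X. norm ((x - a) + v)) + (blinfun_apply y a - m - blinfun_apply y v)" for v
  define D where "D = (+) a ` U"
  have cD: "convex D" unfolding D_def using U by (simp add: subspace_imp_convex convex_translation)
  have "convex_on D (\<lambda>v. \<Sum>x\<in>(\<lambda>x. x - a) ` X. norm (x + v))"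
    using insert(1) cD by (intro convex_on_sum_of_norms) auto
  then have "convex_on D (\<lambda>v. \<Sum>x\<in>X. norm ((x - a) + v))"
    by (subst (asm) sum.reindex) (auto simp: inj_on_def)
  moreover have "convex_on D (\<lambda>v. blinfun_apply y a - m - blinfun_apply y v)"
    unfolding convex_on_def
  proof (intro conjI cD ballI allI impI)
    fix v w and s t :: real assume "s + t = 1"
    then have t: "t = 1 - s" by simp
    show "blinfun_apply y a - m - blinfun_apply y (s *\<^sub>R v + t *\<^sub>R w)
      \<le> s * (blinfun_apply y a - m - blinfun_apply y v) + t * (blinfun_apply y a - m - blinfun_apply y w)"
      unfolding t by (simp add: blinfun.bilinear_simps algebra_simps)
  qed
  ultimately have \<Psi>: "convex_on D \<Psi>" unfolding \<Psi>_def by (rule convex_on_add)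
  have D: "D \<noteq> {}" unfolding D_def using subspace_0[OF U] by blast
  have "0 \<le> norm v + \<Psi> v" if v: "v \<in> D" for v
  proof -
    obtain r where r: "r \<in> U" "v = a + r" using v by (auto simp: D_def)
    show ?thesis
      using insert(4)[OF r(1)] insert(1,2) r(2)
      by (simp add: \<Psi>_def blinfun.add_right algebra_simps)
  qed
  then obtain q0 where q0: "linear q0" "\<And>x. q0 x \<le> norm x" "\<And>v. v \<in> D \<Longrightarrow> 0 \<le> q0 v + \<Psi> v"
    using sublinear_convex_sandwich[OF fd sublinear_norm \<Psi> D] by blast
  obtain q where q: "q \<in> dual_ball" "blinfun_apply q = q0" using dual_ball_of_linear[OF q0(1,2)] by blast
  have "m - blinfun_apply q a \<le> (\<Sum>x\<in>X. norm (x + r)) - blinfun_apply (y - q) r" if r: "r \<in> U" for r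
  proof -
    have "0 \<le> blinfun_apply q (a + r) + \<Psi> (a + r)" using q0(3) q(2) r by (auto simp: D_def)
    then show ?thesis by (simp add: \<Psi>_def blinfun.add_right blinfun.diff_left algebra_simps)
  qed
  then obtain Q where Q: "\<forall>x\<in>X. Q x \<in> dual_ball"
    "\<forall>r\<in>U. (\<Sum>x\<in>X. blinfun_apply (Q x) r) = blinfun_apply (y - q) r"
    "m - blinfun_apply q a \<le> (\<Sum>x\<in>X. blinfun_apply (Q x) x)"
    using insert(3) by blast
  have "(\<Sum>x\<in>X. blinfun_apply ((Q(a := q)) x) z) = (\<Sum>x\<in>X. blinfun_apply (Q x) z)" for z
    using insert(2) by (intro sum.cong) auto
  moreover have "(\<Sum>x\<in>X. blinfun_apply ((Q(a := q)) x) x) = (\<Sum>x\<in>X. blinfun_apply (Q x) x)"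
    using insert(2) by (intro sum.cong) auto
  ultimately show ?case
    using insert(1,2) Q q(1)
    by (intro exI[of _ "Q(a := q)"]) (auto simp: blinfun.diff_left)
qed

text \<open>
  Each term \<open>\<parallel>x + r\<parallel> - e0 r\<close> is at least \<open>\<sigma>\<^sub>E x\<close>, so it is enough to bring the sum of these terms
  within \<open>\<epsilon>\<close> of the sum of the \<open>\<sigma>\<^sub>E x\<close>. If that were impossible, duality would give functionals
  \<open>Q x\<close> in the dual ball, with mean equal to \<open>e0\<close> on \<open>U\<close>, whose values at the \<open>x\<close> have too large
  a sum; but the mean lies in \<open>E\<close>, hence so do the \<open>Q x\<close>, and \<open>\<sigma>\<^sub>E\<close> bounds their values.
\<close>
lemma norm_approximates_support_of_face:
  fixes E :: "('a::real_normed_vector \<Rightarrow>\<^sub>L real) set"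
  assumes fd: "finite S" "span S = (UNIV :: 'a set)"
    and face: "E face_of dual_ball" and e0: "e0 \<in> E" and X: "finite X" and \<epsilon>: "0 < \<epsilon>"
  obtains r where "\<And>e. e \<in> E \<Longrightarrow> blinfun_apply e r = blinfun_apply e0 r"
    "\<And>x. x \<in> X \<Longrightarrow> norm (x + r) \<le> support E x + blinfun_apply e0 r + \<epsilon>"
proof -
  have sub: "E \<subseteq> dual_ball" using face by (simp add: face_of_def)
  have ne: "E \<noteq> {}" using e0 by blast
  define U where "U = {r. \<forall>e\<in>E. blinfun_apply e r = blinfun_apply e0 r}"
  have U: "subspace U"
    unfolding U_def subspace_def by (auto simp: blinfun.add_right blinfun.scaleR_right)
  define k where "k = real (card X)"
  have ge: "support E x + blinfun_apply e0 r \<le> norm (x + r)" if "r \<in> U" for x r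
    using support_add_constant[OF sub ne, of r "blinfun_apply e0 r" x] support_le_norm[OF sub ne, of "x + r"] that
    by (simp add: U_def)
  have "\<exists>r\<in>U. (\<Sum>x\<in>X. norm (x + r)) - blinfun_apply (k *\<^sub>R e0) r \<le> (\<Sum>x\<in>X. support E x) + \<epsilon>"
  proof (rule ccontr)
    assume "\<not> ?thesis"
    then have "(\<Sum>x\<in>X. support E x) + \<epsilon> \<le> (\<Sum>x\<in>X. norm (x + r)) - blinfun_apply (k *\<^sub>R e0) r"
      if "r \<in> U" for r using that by force
    from sum_norms_lagrange[OF fd U X this]
    obtain Q where Q: "\<And>x. x \<in> X \<Longrightarrow> Q x \<in> dual_ball"
      "\<And>r. r \<in> U \<Longrightarrow> (\<Sum>x\<in>X. blinfun_apply (Q x) r) = blinfun_apply (k *\<^sub>R e0) r"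
      "(\<Sum>x\<in>X. support E x) + \<epsilon> \<le> (\<Sum>x\<in>X. blinfun_apply (Q x) x)"
      by blast
    have "Q a \<in> E" if a: "a \<in> X" for a
    proof -
      have k: "1 \<le> k" using a X by (simp add: k_def Suc_le_eq card_gt_0_iff) blast
      have k1: "k - 1 = real (card (X - {a}))"
        using a X k by (simp add: k_def card_Diff_singleton of_nat_diff)
      have mean: "(1 / real n) *\<^sub>R (\<Sum>x\<in>Y. Q x) \<in> dual_ball" if "Y \<subseteq> X" "n = card Y" for Y n
        unfolding dual_ball_iff
      proof
        fix v
        have "(\<Sum>x\<in>Y. blinfun_apply (Q x) v) \<le> (\<Sum>x\<in>Y. norm v)"
          using Q(1) that by (intro sum_mono dual_ball_le) auto
        then have "(\<Sum>x\<in>Y. blinfun_apply (Q x) v) \<le> real n * norm v" using that by simp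
        then show "blinfun_apply ((1 / real n) *\<^sub>R (\<Sum>x\<in>Y. Q x)) v \<le> norm v"
          by (cases "n = 0") (simp_all add: blinfun.scaleR_left blinfun.sum_left field_simps)
      qed
      have "(1 / k) *\<^sub>R (\<Sum>x\<in>X. Q x) \<in> E"
      proof (rule dual_ball_affine_hull_face[OF fd face e0])
        show "(1 / k) *\<^sub>R (\<Sum>x\<in>X. Q x) \<in> dual_ball" unfolding k_def by (rule mean) auto
        fix r assume "\<And>e. e \<in> E \<Longrightarrow> blinfun_apply e r = blinfun_apply e0 r"
        then have "r \<in> U" by (simp add: U_def)
        from Q(2)[OF this] show "blinfun_apply ((1 / k) *\<^sub>R (\<Sum>x\<in>X. Q x)) r = blinfun_apply e0 r"
          using k by (simp add: blinfun.scaleR_left blinfun.sum_left)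
      qed
      \<comment> \<open>For a single point the remaining mean is \<open>0\<close>, with weight \<open>0\<close>.\<close>
      moreover have "(1 / k) *\<^sub>R (\<Sum>x\<in>X. Q x)
        = (1 / k) *\<^sub>R Q a + ((k - 1) / k) *\<^sub>R ((1 / (k - 1)) *\<^sub>R (\<Sum>x\<in>X - {a}. Q x))"
      proof (cases "k = 1")
        case True
        then have "card X = 1" by (simp add: k_def)
        then have "X = {a}" using a by (auto simp: card_1_singleton_iff)
        then show ?thesis using True by simp
      next
        case False
        then show ?thesis using sum.remove[OF X a, of Q] by (simp add: scaleR_add_right)
      qed
      moreover have "(1 / (k - 1)) *\<^sub>R (\<Sum>x\<in>X - {a}. Q x) \<in> dual_ball"
        unfolding k1 by (rule mean) auto
      ultimately show ?thesis
        using k by (intro face_of_combination[OF face Q(1)[OF a], of "(1 / (k - 1)) *\<^sub>R (\<Sum>x\<in>X - {a}. Q x)" "1 / k" "(k - 1) / k"])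
          (auto simp flip: add_divide_distrib)
    qed
    then have "(\<Sum>x\<in>X. blinfun_apply (Q x) x) \<le> (\<Sum>x\<in>X. support E x)"
      by (intro sum_mono support_upper[OF sub])
    then show False using Q(3) \<epsilon> by simp
  qed
  then obtain r where r: "r \<in> U"
    "(\<Sum>x\<in>X. norm (x + r)) - blinfun_apply (k *\<^sub>R e0) r \<le> (\<Sum>x\<in>X. support E x) + \<epsilon>" by blast
  have "norm (a + r) \<le> support E a + blinfun_apply e0 r + \<epsilon>" if a: "a \<in> X" for a
  proof -
    define d where "d x = norm (x + r) - support E x - blinfun_apply e0 r" for x
    have "d a \<le> (\<Sum>x\<in>X. d x)" using ge[OF r(1)] a X by (intro member_le_sum) (auto simp: d_def algebra_simps)
    also have "\<dots> \<le> \<epsilon>" using r(2) by (simp add: d_def sum_subtractf k_def blinfun.scaleR_left)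
    finally show ?thesis by (simp add: d_def)
  qed
  then show ?thesis using that[of r] r(1) by (simp add: U_def)
qed

section \<open>The transforms as differences of support functions\<close>

text \<open>
  Outside \<open>E\<close> the function contributes \<open>- \<infinity>\<close> to the supremum, and on \<open>E\<close> its infimum term is
  \<open>- support E (- p)\<close>.
\<close>
lemma legendre_fenchel_face_fun:
  assumes E: "E \<subseteq> dual_ball" "E \<noteq> {}"
  shows "legendre_fenchel (face_fun E p) x = ereal (support E (x - p) - support E (- p))"
proof -
  obtain e0 where e0: "e0 \<in> E" using E by blast
  define I where "I = (INF y\<in>E. ereal (blinfun_apply y p))"
  have I: "I = ereal (- support E (- p))"
  proof (rule antisym)
    have ge: "ereal (- support E (- p)) \<le> I"
      unfolding I_def
      using support_upper[OF E(1), of _ "- p"] by (intro INF_greatest) (simp add: blinfun.minus_right minus_le_iff)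
    then show "ereal (- support E (- p)) \<le> I" .
    have le: "I \<le> ereal (blinfun_apply y p)" if "y \<in> E" for y
      unfolding I_def using that by (rule INF_lower)
    obtain i where i: "I = ereal i" using ge le[OF e0] by (cases I) auto
    have "support E (- p) \<le> - i"
      using le by (intro support_least[OF E(2)]) (simp add: i blinfun.minus_right)
    then show "I \<le> ereal (- support E (- p))" by (simp add: i)
  qed
  have fE: "ereal (blinfun_apply q x) - face_fun E p q = ereal (blinfun_apply q (x - p) - support E (- p))"
    if "q \<in> E" for q
    using that by (simp add: face_fun_def I[unfolded I_def] blinfun.diff_right)
  have fN: "ereal (blinfun_apply q x) - face_fun E p q = - \<infinity>" if "q \<notin> E" for q
    using that by (simp add: face_fun_def I[unfolded I_def])
  define Z where "Z = legendre_fenchel (face_fun E p) x"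
  have le: "Z \<le> ereal (support E (x - p) - support E (- p))"
    unfolding Z_def legendre_fenchel_def
  proof (rule SUP_least)
    fix q
    show "ereal (blinfun_apply q x) - face_fun E p q \<le> ereal (support E (x - p) - support E (- p))"
      using fE[of q] fN[of q] support_upper[OF E(1), of q "x - p"] by (cases "q \<in> E") auto
  qed
  have ge: "ereal (blinfun_apply q (x - p) - support E (- p)) \<le> Z" if "q \<in> E" for q
    unfolding Z_def legendre_fenchel_def fE[OF that, symmetric] by (rule SUP_upper) simp
  obtain z where z: "Z = ereal z" using le ge[OF e0] by (cases Z) auto
  have "support E (x - p) \<le> z + support E (- p)"
    using ge by (intro support_least[OF E(2)]) (simp add: z algebra_simps)
  then show ?thesis using le by (simp add: z flip: Z_def)
qed

section \<open>Convergence to horofunctions\<close>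

lemma horo_dist_lipschitz: "horo_dist z x \<le> horo_dist z y + norm (x - y)"
  using norm_triangle_ineq[of "z - y" "y - x"] by (simp add: horo_dist_def norm_minus_commute)

text \<open>
  Pointwise convergence on a finite net of \<open>K\<close> controls all of \<open>K\<close>. This reduces convergence
  in the topology of the horofunction compactification to convergence at single points.
\<close>
lemma lipschitz_pointwise_imp_uniform_on_compact:
  fixes f :: "'i \<Rightarrow> 'a::real_normed_vector \<Rightarrow> real"
  assumes f: "\<And>n x y. f n x \<le> f n y + norm (x - y)" and h: "\<And>x y. h x \<le> h y + norm (x - y)"
    and lim: "\<And>x. ((\<lambda>n. f n x) \<longlongrightarrow> h x) F" and K: "compact K"
  shows "uniform_limit K f h F"
proof (rule uniform_limitI)
  fix e :: real assume e: "0 < e"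
  then have "0 < e / 3" by simp
  then obtain X where X: "finite X" "K \<subseteq> (\<Union>x\<in>X. ball x (e / 3))"
    using compact_imp_seq_compact[OF K, THEN seq_compact_imp_totally_bounded] by blast
  have "\<forall>\<^sub>F n in F. \<forall>x\<in>X. dist (f n x) (h x) < e / 3"
    using X(1) tendstoD[OF lim \<open>0 < e / 3\<close>] by (simp add: eventually_ball_finite)
  then show "\<forall>\<^sub>F n in F. \<forall>x\<in>K. dist (f n x) (h x) < e"
  proof eventually_elim
    case (elim n)
    show ?case
    proof
      fix x assume "x \<in> K"
      then obtain y where y: "y \<in> X" "norm (x - y) < e / 3"
        using X(2) by (auto simp: dist_norm norm_minus_commute)
      then have "dist (f n y) (h y) < e / 3" using elim by simp
      then show "dist (f n x) (h x) < e"
        using f[of n x y] f[of n y x] h[of x y] h[of y x] y(2)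
        unfolding dist_real_def norm_minus_commute[of y x] by linarith
    qed
  qed
qed

text \<open>
  Finite sets that approximate every point of the space in the limit, so that a recursive choice
  with finitely many conditions at each stage still forces convergence everywhere. In the
  direction \<open>b\<close> the coefficients with denominator \<open>n + 1\<close> and absolute value up to \<open>n + 1\<close> are
  used.
\<close>
lemma span_finite_nets:
  fixes S :: "'a::real_normed_vector set"
  assumes "finite S"
  obtains X :: "nat \<Rightarrow> 'a set" where "\<And>n. finite (X n)"
    "\<And>x. x \<in> span S \<Longrightarrow> \<exists>y. (\<forall>\<^sub>F n in sequentially. y n \<in> X n) \<and> y \<longlonglongrightarrow> x"
proof -
  have "\<exists>X :: nat \<Rightarrow> 'a set. (\<forall>n. finite (X n)) \<and>
      (\<forall>x\<in>span S. \<exists>y. (\<forall>\<^sub>F n in sequentially. y n \<in> X n) \<and> y \<longlonglongrightarrow> x)"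
    using assms
  proof induction
    case empty
    show ?case by (rule exI[of _ "\<lambda>_. {0}"]) (auto intro!: exI[of _ "\<lambda>_. 0"])
  next
    case (insert b B)
    then obtain X :: "nat \<Rightarrow> 'a set" where X: "\<And>n. finite (X n)"
      "\<And>x. x \<in> span B \<Longrightarrow> \<exists>y. (\<forall>\<^sub>F n in sequentially. y n \<in> X n) \<and> y \<longlonglongrightarrow> x" by blast
    define G where "G n = (\<lambda>j. of_int j / real (Suc n)) ` {- (int (Suc n))\<^sup>2 .. (int (Suc n))\<^sup>2}" for n
    define X' where "X' n = (\<lambda>(y, c). y + c *\<^sub>R b) ` (X n \<times> G n)" for n
    have "\<exists>y. (\<forall>\<^sub>F n in sequentially. y n \<in> X' n) \<and> y \<longlonglongrightarrow> x" if "x \<in> span (insert b B)" for x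
    proof -
      obtain k where "x - k *\<^sub>R b \<in> span B" using \<open>x \<in> span (insert b B)\<close> by (auto simp: span_insert)
      then obtain y where y: "\<forall>\<^sub>F n in sequentially. y n \<in> X n" "y \<longlonglongrightarrow> x - k *\<^sub>R b" using X(2) by blast
      define c where "c n = of_int \<lfloor>real (Suc n) * k\<rfloor> / real (Suc n)" for n
      have c: "\<bar>c n - k\<bar> \<le> 1 / real (Suc n)" for n
      proof -
        have "c n - k = (of_int \<lfloor>real (Suc n) * k\<rfloor> - real (Suc n) * k) / real (Suc n)"
          by (simp add: c_def field_simps)
        moreover have "\<bar>of_int \<lfloor>real (Suc n) * k\<rfloor> - real (Suc n) * k\<bar> \<le> 1" by linarith
        ultimately show ?thesis by (simp add: divide_right_mono)
      qed
      have "c \<longlonglongrightarrow> k"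
        using c LIMSEQ_inverse_real_of_nat
        by (intro Lim_null_comparison[THEN LIM_zero_cancel, of c k]) (auto simp: inverse_eq_divide)
      have "c n \<in> G n" if n: "\<bar>k\<bar> + 1 \<le> real n" for n
      proof -
        have "\<bar>real (Suc n) * k\<bar> \<le> real (Suc n) * (real n - 1)"
          using n by (simp add: abs_mult)
        also have "\<dots> = (real (Suc n))\<^sup>2 - 2 * real (Suc n)" by (simp add: power2_eq_square algebra_simps)
        also have "\<dots> \<le> (real (Suc n))\<^sup>2 - 1" by simp
        finally have "\<bar>real_of_int \<lfloor>real (Suc n) * k\<rfloor>\<bar> \<le> real_of_int ((int (Suc n))\<^sup>2)"
          by (simp only: of_int_power of_int_of_nat_eq) linarith
        then have "\<bar>\<lfloor>real (Suc n) * k\<rfloor>\<bar> \<le> (int (Suc n))\<^sup>2" by linarith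
        then show ?thesis unfolding G_def c_def by (intro imageI) auto
      qed
      moreover have "\<forall>\<^sub>F n in sequentially. \<bar>k\<bar> + 1 \<le> real n"
        using filterlim_real_sequentially by (simp add: filterlim_at_top)
      ultimately have "\<forall>\<^sub>F n in sequentially. c n \<in> G n" by (rule eventually_mono[rotated])
      with y(1) have "\<forall>\<^sub>F n in sequentially. y n + c n *\<^sub>R b \<in> X' n"
        by eventually_elim (auto simp: X'_def)
      moreover have "(\<lambda>n. y n + c n *\<^sub>R b) \<longlonglongrightarrow> (x - k *\<^sub>R b) + k *\<^sub>R b"
        by (intro tendsto_intros y(2) \<open>c \<longlonglongrightarrow> k\<close>)
      ultimately show ?thesis by (intro exI[of _ "\<lambda>n. y n + c n *\<^sub>R b"]) simp
    qed
    moreover have "finite (X' n)" for n using X(1) by (simp add: X'_def G_def)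
    ultimately show ?case by blast
  qed
  then show ?thesis using that by blast
qed

text \<open>
  The sequence becomes an almost-geodesic when its \<open>n\<close>-th element gets the parameter
  \<open>norm (z n)\<close>. The gap condition makes the norms strictly increasing, hence usable as
  parameters, and unbounded.
\<close>
lemma busemann_point_of_sequence:
  fixes z :: "nat \<Rightarrow> 'a::real_normed_vector"
  assumes z0: "z 0 = 0" and gap: "\<And>n. norm (z n) + 1 \<le> norm (z (Suc n))"
    and detour: "\<And>m n. 0 < m \<Longrightarrow> m < n \<Longrightarrow> norm (z n - z m) + norm (z m) - norm (z n) \<le> 2 / real m"
    and lim: "\<And>x. (\<lambda>n. horo_dist (z n) x) \<longlonglongrightarrow> h x" and notin: "h \<notin> range horo_dist"
  shows "h \<in> busemann_points"
proof -
  define N where "N n = norm (z n)" for n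
  have "strict_mono N" by (intro strict_monoI_Suc) (smt (verit) gap N_def)
  have N_ge: "real n \<le> N n" for n
  proof (induction n)
    case (Suc n)
    then show ?case using gap[of n] by (simp add: N_def)
  qed (simp add: N_def)
  define T where "T = range N"
  define \<gamma> where "\<gamma> t = z (inv N t)" for t
  have \<gamma>: "\<gamma> (N n) = z n" for n
    using strict_mono_imp_inj_on[OF \<open>strict_mono N\<close>] by (simp add: \<gamma>_def)
  have N0: "N 0 = 0" by (simp add: N_def z0)
  have \<gamma>0: "\<gamma> 0 = 0" using \<gamma>[of 0] by (simp add: N0 z0)
  have "almost_geodesic T \<gamma>"
    unfolding almost_geodesic_def
  proof (intro conjI allI impI)
    show "T \<subseteq> {0..}" by (auto simp: T_def N_def)
    show "0 \<in> T" unfolding T_def using N0 by (metis rangeI)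
    show "\<not> bounded T"
    proof
      assume "bounded T"
      then obtain b where b: "\<And>n. \<bar>N n\<bar> \<le> b" by (auto simp: bounded_iff T_def)
      obtain n where "b < real n" using reals_Archimedean2 by blast
      then show False using N_ge[of n] b[of n] by linarith
    qed
    fix e :: real assume e: "0 < e"
    obtain M where M: "2 / e < real M" using reals_Archimedean2 by blast
    then have "0 < M" using e by (metis divide_pos_pos of_nat_0_less_iff less_trans zero_less_numeral)
    show "\<exists>M. \<forall>s\<in>T. \<forall>t\<in>T. M \<le> s \<and> s \<le> t \<longrightarrow> \<bar>dist (\<gamma> t) (\<gamma> s) + dist (\<gamma> s) (\<gamma> 0) - t\<bar> < e"
    proof (intro exI[of _ "N M"] ballI impI)
      fix s t assume "s \<in> T" "t \<in> T" "N M \<le> s \<and> s \<le> t"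
      then obtain m n where m: "s = N m" and n: "t = N n" and mn: "M \<le> m" "m \<le> n"
        using strict_mono_less_eq[OF \<open>strict_mono N\<close>] by (auto simp: T_def)
      have "dist (\<gamma> t) (\<gamma> s) + dist (\<gamma> s) (\<gamma> 0) - t = norm (z n - z m) + norm (z m) - norm (z n)"
        by (simp add: m n \<gamma> \<gamma>0 dist_norm) (simp add: N_def)
      moreover have "0 \<le> norm (z n - z m) + norm (z m) - norm (z n)"
        using norm_triangle_ineq[of "z n - z m" "z m"] by simp
      moreover have "norm (z n - z m) + norm (z m) - norm (z n) < e"
      proof (cases "m = n")
        case False
        then have "norm (z n - z m) + norm (z m) - norm (z n) \<le> 2 / real m"
          using mn \<open>0 < M\<close> by (intro detour) auto
        also have "\<dots> \<le> 2 / real M" using mn \<open>0 < M\<close> by (intro divide_left_mono) auto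
        also have "\<dots> < e" using M e \<open>0 < M\<close> by (simp add: field_simps)
        finally show ?thesis .
      qed (simp add: e)
      ultimately show "\<bar>dist (\<gamma> t) (\<gamma> s) + dist (\<gamma> s) (\<gamma> 0) - t\<bar> < e" by simp
    qed
  qed
  moreover
  have h: "h x \<le> h y + norm (x - y)" for x y
    by (rule LIMSEQ_le[OF lim tendsto_add[OF lim tendsto_const]]) (use horo_dist_lipschitz in blast)
  have lim_T: "((\<lambda>t. horo_dist (\<gamma> t) x) \<longlongrightarrow> h x) (inf at_top (principal T))" for x
  proof (rule tendstoI)
    fix e :: real assume "0 < e"
    from tendstoD[OF lim this] obtain n0
      where n0: "\<And>n. n0 \<le> n \<Longrightarrow> dist (horo_dist (z n) x) (h x) < e"
      by (auto simp: eventually_sequentially)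
    have "t \<in> T \<longrightarrow> dist (horo_dist (\<gamma> t) x) (h x) < e" if "N n0 \<le> t" for t
      using n0 that strict_mono_less_eq[OF \<open>strict_mono N\<close>] by (auto simp: T_def \<gamma>)
    then show "\<forall>\<^sub>F t in inf at_top (principal T). dist (horo_dist (\<gamma> t) x) (h x) < e"
      unfolding eventually_inf_principal by (rule eventually_at_top_linorderI)
  qed
  have "uniform_limit K (\<lambda>t. horo_dist (\<gamma> t)) h (inf at_top (principal T))" if "compact K" for K
    by (rule lipschitz_pointwise_imp_uniform_on_compact[OF horo_dist_lipschitz h lim_T that])
  moreover have "h \<in> horofunctions"
    unfolding horofunctions_def
  proof (intro DiffI notin)
    have "dist (h x) (h y) \<le> 1 * dist x y" for x y
      using h[of x y] h[of y x] by (simp add: dist_norm norm_minus_commute abs_le_iff)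
    then have cont: "continuous_on UNIV h"
      by (intro lipschitz_on_continuous_on[of 1] lipschitz_onI) auto
    show "h \<in> ucc_topology closure_of range horo_dist"
      unfolding in_closure_of topspace_ucc_topology openin_ucc_topology
    proof (intro conjI allI impI)
      show "h \<in> {f. continuous_on UNIV f}" using cont by simp
      fix U assume "h \<in> U \<and> ucc_open U"
      then obtain K e where K: "compact K" "0 < e"
        "{g. continuous_on UNIV g \<and> (\<forall>x\<in>K. dist (g x) (h x) < e)} \<subseteq> U"
        unfolding ucc_open_def by meson
      have "uniform_limit K (\<lambda>n. horo_dist (z n)) h sequentially"
        by (rule lipschitz_pointwise_imp_uniform_on_compact[OF horo_dist_lipschitz h lim K(1)])
      from uniform_limitD[OF this K(2)] obtain n where "\<forall>x\<in>K. dist (horo_dist (z n) x) (h x) < e"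
        using eventually_happens trivial_limit_sequentially by blast
      moreover have "continuous_on UNIV (horo_dist (z n))"
        unfolding horo_dist_def by (intro continuous_intros)
      ultimately show "\<exists>y. y \<in> range horo_dist \<and> y \<in> U" using K(3) by blast
    qed
  qed
  ultimately show ?thesis unfolding busemann_points_def by blast
qed

section \<open>Proper faces give Busemann points\<close>

text \<open>
  Take \<open>z = p - r\<close> with \<open>r\<close> approximating at \<open>- p\<close> and at the points \<open>x - p\<close>, since
  \<open>\<phi>\<^sub>z x = \<parallel>x - p + r\<parallel> - \<parallel>- p + r\<parallel>\<close>. That \<open>z\<close> is long comes for free from one more test point
  \<open>y\<close>, at which \<open>h\<close> is very negative: \<open>\<phi>\<^sub>z\<close> is bounded below by \<open>- \<parallel>z\<parallel>\<close>.
\<close>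
lemma face_function_approximation:
  fixes E :: "('a::real_normed_vector \<Rightarrow>\<^sub>L real) set"
  assumes fd: "finite S" "span S = (UNIV :: 'a set)"
    and face: "E face_of dual_ball" and ne: "E \<noteq> {}" and proper: "E \<noteq> dual_ball"
    and X: "finite X" and \<epsilon>: "0 < \<epsilon>"
    and h: "\<And>x. h x = support E (x - p) - support E (- p)"
  obtains z where "M \<le> norm z" "norm z + h z \<le> \<epsilon>" "\<And>x. x \<in> X \<Longrightarrow> \<bar>horo_dist z x - h x\<bar> \<le> \<epsilon>"
proof -
  have sub: "E \<subseteq> dual_ball" using face by (simp add: face_of_def)
  obtain e0 where e0: "e0 \<in> E" using ne by blast
  obtain v where v: "support E v < 0" using support_negative_of_proper_face[OF fd face ne proper] .
  define c where "c = (\<bar>M\<bar> + \<epsilon> + \<bar>support E (- p)\<bar>) / (- support E v)"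
  have c: "0 \<le> c" "c * support E v = - (\<bar>M\<bar> + \<epsilon> + \<bar>support E (- p)\<bar>)"
    using v \<epsilon> by (simp_all add: c_def field_simps)
  define y where "y = p + c *\<^sub>R v"
  have hy: "h y \<le> - M - \<epsilon>"
    using support_scale_le[OF sub ne c(1), of v] c(2) by (simp add: h y_def)
  obtain r where r: "\<And>e. e \<in> E \<Longrightarrow> blinfun_apply e r = blinfun_apply e0 r"
    and le: "\<And>x. x \<in> insert (- p) ((\<lambda>x. x - p) ` insert y X) \<Longrightarrow>
      norm (x + r) \<le> support E x + blinfun_apply e0 r + \<epsilon>"
    using norm_approximates_support_of_face[OF fd face e0 _ \<epsilon>, of "insert (- p) ((\<lambda>x. x - p) ` insert y X)"]
      X by auto
  have ge: "support E x + blinfun_apply e0 r \<le> norm (x + r)" for x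
    using support_add_constant[OF sub ne r, of x] support_le_norm[OF sub ne, of "x + r"] by simp
  have phi: "horo_dist (p - r) x = norm ((x - p) + r) - norm (- p + r)" for x
    unfolding horo_dist_def by (metis (no_types, opaque_lifting) add.commute diff_add_eq diff_diff_eq2 minus_diff_eq norm_minus_commute uminus_add_conv_diff)
  have approx: "\<bar>horo_dist (p - r) x - h x\<bar> \<le> \<epsilon>" if "x \<in> insert y X" for x
  proof -
    have "x - p \<in> insert (- p) ((\<lambda>x. x - p) ` insert y X)" using that by blast
    then show ?thesis
      using le[of "x - p"] ge[of "x - p"] le[of "- p"] ge[of "- p"] by (simp add: phi h abs_le_iff)
  qed
  show ?thesis
  proof
    show "\<bar>horo_dist (p - r) x - h x\<bar> \<le> \<epsilon>" if "x \<in> X" for x using approx that by simp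
    have "- norm (p - r) \<le> horo_dist (p - r) y" by (simp add: horo_dist_def)
    also have "\<dots> \<le> h y + \<epsilon>" using approx[of y] by (simp add: abs_le_iff)
    also have "\<dots> \<le> - M" using hy by simp
    finally show "M \<le> norm (p - r)" by simp
    have "support E (0 + - r) = support E 0 + - blinfun_apply e0 r"
      using r by (intro support_add_constant[OF sub ne]) (simp add: blinfun.minus_right)
    moreover have "support E 0 \<le> 0" using support_le_norm[OF sub ne, of 0] by simp
    moreover have "norm (p - r) = norm (- p + r)" by (metis minus_diff_eq norm_minus_cancel uminus_add_conv_diff)
    ultimately show "norm (p - r) + h (p - r) \<le> \<epsilon>"
      using le[of "- p"] by (simp add: h)
  qed
qed

text \<open>
  The recursion carries the finite set of all earlier points together with the current point. At
  stage \<open>n + 1\<close> the new point approximates \<open>h\<close> up to \<open>1 / (n + 1)\<close> on that set and on the \<open>n\<close>-th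
  net. As \<open>h\<close> is unbounded below and every \<open>\<phi>\<^sub>w\<close> is bounded below, \<open>h\<close> is not of the form \<open>\<phi>\<^sub>w\<close>.
\<close>
lemma face_function_busemann:
  fixes E :: "('a::real_normed_vector \<Rightarrow>\<^sub>L real) set"
  assumes fd: "finite S" "span S = (UNIV :: 'a set)"
    and face: "E face_of dual_ball" and ne: "E \<noteq> {}" and proper: "E \<noteq> dual_ball"
  shows "(\<lambda>x. support E (x - p) - support E (- p)) \<in> busemann_points"
proof -
  have sub: "E \<subseteq> dual_ball" using face by (simp add: face_of_def)
  define h where "h = (\<lambda>x. support E (x - p) - support E (- p))"
  note approx = face_function_approximation[OF fd face ne proper _ _ fun_cong[OF h_def]]
  obtain X :: "nat \<Rightarrow> 'a set" where X: "\<And>n. finite (X n)"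
    "\<And>x. x \<in> span S \<Longrightarrow> \<exists>y. (\<forall>\<^sub>F n in sequentially. y n \<in> X n) \<and> y \<longlonglongrightarrow> x"
    using span_finite_nets[OF fd(1)] by blast
  define P :: "nat \<Rightarrow> 'a set \<times> 'a \<Rightarrow> bool"
    where "P n s \<longleftrightarrow> finite (fst s) \<and> snd s \<in> fst s \<and> (n = 0 \<longrightarrow> snd s = 0)" for n s
  define Q :: "nat \<Rightarrow> 'a set \<times> 'a \<Rightarrow> 'a set \<times> 'a \<Rightarrow> bool"
    where "Q n s s' \<longleftrightarrow> fst s' = insert (snd s') (fst s) \<and> norm (snd s) + 1 \<le> norm (snd s') \<and>
      norm (snd s') + h (snd s') \<le> 1 / real (Suc n) \<and>
      (\<forall>x\<in>fst s \<union> X n. \<bar>horo_dist (snd s') x - h x\<bar> \<le> 1 / real (Suc n))" for n s s'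
  have "\<exists>f. \<forall>n. P n (f n) \<and> Q n (f n) (f (Suc n))"
  proof (rule dependent_nat_choice)
    show "\<exists>s. P 0 s" by (rule exI[of _ "({0}, 0)"]) (simp add: P_def)
    fix s n assume s: "P n s"
    obtain z where "norm (snd s) + 1 \<le> norm z" "norm z + h z \<le> 1 / real (Suc n)"
      "\<And>x. x \<in> fst s \<union> X n \<Longrightarrow> \<bar>horo_dist z x - h x\<bar> \<le> 1 / real (Suc n)"
      using approx[of "fst s \<union> X n" "1 / real (Suc n)" "norm (snd s) + 1"] s X(1)
      by (auto simp: P_def)
    then show "\<exists>s'. P (Suc n) s' \<and> Q n s s'"
      using s by (intro exI[of _ "(insert z (fst s), z)"]) (auto simp: P_def Q_def)
  qed
  then obtain f where f: "\<And>n. P n (f n)" "\<And>n. Q n (f n) (f (Suc n))" by blast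
  define z where "z n = snd (f n)" for n
  have mem: "z m \<in> fst (f n)" if "m \<le> n" for m n
    using that
  proof (induction rule: dec_induct)
    case base
    then show ?case using f(1) by (simp add: P_def z_def)
  next
    case (step n)
    then show ?case using f(2)[of n] by (simp add: Q_def)
  qed
  have "h \<in> busemann_points"
  proof (rule busemann_point_of_sequence)
    show "z 0 = 0" using f(1)[of 0] by (simp add: P_def z_def)
    show "norm (z n) + 1 \<le> norm (z (Suc n))" for n using f(2)[of n] by (simp add: Q_def z_def)
    fix m n :: nat assume mn: "0 < m" "m < n"
    obtain m' n' where m': "m = Suc m'" and n': "n = Suc n'" using mn by (metis Suc_pred less_trans)
    have "\<bar>horo_dist (z n) (z m) - h (z m)\<bar> \<le> 1 / real n"
      using f(2)[of n'] mem[of m n'] mn unfolding Q_def z_def n' by auto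
    moreover have "norm (z m) + h (z m) \<le> 1 / real m"
      using f(2)[of m'] unfolding Q_def z_def m' by auto
    moreover have "1 / real n \<le> 1 / real m" using mn by (simp add: field_simps)
    ultimately show "norm (z n - z m) + norm (z m) - norm (z n) \<le> 2 / real m"
      by (simp add: horo_dist_def abs_le_iff)
  next
    fix x :: 'a
    obtain y where y: "\<forall>\<^sub>F n in sequentially. y n \<in> X n" "y \<longlonglongrightarrow> x" using X(2) fd(2) by blast
    have h_lip: "h a \<le> h b + norm (a - b)" for a b
      using support_lipschitz[OF sub ne, of "a - p" "b - p"] by (simp add: h_def)
    have bound: "\<forall>\<^sub>F n in sequentially. norm (horo_dist (z (Suc n)) x - h x) \<le> 2 * norm (y n - x) + inverse (real (Suc n))"
      using y(1)
    proof eventually_elim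
      case (elim n)
      then have "\<bar>horo_dist (z (Suc n)) (y n) - h (y n)\<bar> \<le> inverse (real (Suc n))"
        using f(2)[of n] unfolding Q_def z_def by (auto simp: inverse_eq_divide)
      then show ?case
        using horo_dist_lipschitz[of "z (Suc n)" x "y n"] horo_dist_lipschitz[of "z (Suc n)" "y n" x]
          h_lip[of x "y n"] h_lip[of "y n" x]
        by (simp add: norm_minus_commute abs_le_iff)
    qed
    have "(\<lambda>n. 2 * norm (y n - x) + inverse (real (Suc n))) \<longlonglongrightarrow> 2 * 0 + 0"
      using tendsto_norm_zero[OF LIM_zero[OF y(2)]] LIMSEQ_inverse_real_of_nat by (intro tendsto_intros)
    then have "(\<lambda>n. horo_dist (z (Suc n)) x) \<longlonglongrightarrow> h x"
      by (intro LIM_zero_cancel[OF Lim_null_comparison[OF bound]]) simp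
    then show "(\<lambda>n. horo_dist (z n) x) \<longlonglongrightarrow> h x" by (rule LIMSEQ_imp_Suc)
  next
    show "h \<notin> range horo_dist"
    proof
      assume "h \<in> range horo_dist"
      then obtain w where w: "h = horo_dist w" by blast
      obtain u where u: "norm w + 2 \<le> norm u" "norm u + h u \<le> 1"
        using approx[of "{}" 1 "norm w + 2"] by auto
      have "- norm w \<le> h u" by (simp add: w horo_dist_def)
      then show False using u by simp
    qed
  qed
  then show ?thesis by (simp add: h_def)
qed

section \<open>Busemann points come from proper faces\<close>

lemma almost_increasing_bounded_convergent:
  fixes x :: "nat \<Rightarrow> real"
  assumes inc: "\<And>\<epsilon>. 0 < \<epsilon> \<Longrightarrow> \<exists>N. \<forall>m n. N \<le> m \<and> m \<le> n \<longrightarrow> x m \<le> x n + \<epsilon>"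
    and bdd: "bounded (range x)"
  shows "convergent x"
proof -
  obtain l and \<rho> :: "nat \<Rightarrow> nat" where \<rho>: "strict_mono \<rho>" "(x \<circ> \<rho>) \<longlonglongrightarrow> l"
    using bounded_imp_convergent_subsequence[OF bdd] by blast
  have "x \<longlonglongrightarrow> l"
  proof (rule tendstoI)
    fix e :: real assume e: "0 < e"
    then have e2: "0 < e / 2" by simp
    obtain N where N: "\<And>m n. N \<le> m \<Longrightarrow> m \<le> n \<Longrightarrow> x m \<le> x n + e / 2" using inc[OF e2] by blast
    obtain K where K: "\<And>k. K \<le> k \<Longrightarrow> \<bar>x (\<rho> k) - l\<bar> < e / 2"
      using tendstoD[OF \<rho>(2) e2] by (auto simp: eventually_sequentially dist_real_def)
    define k0 where "k0 = max K N"
    have k0: "N \<le> \<rho> k0" using seq_suble[OF \<rho>(1), of k0] by (simp add: k0_def)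
    have "dist (x n) l < e" if n: "\<rho> k0 \<le> n" for n
    proof -
      define k where "k = max K n"
      have "n \<le> \<rho> k" using seq_suble[OF \<rho>(1), of k] by (simp add: k_def)
      then have "x n \<le> x (\<rho> k) + e / 2" using n k0 by (intro N) auto
      moreover have "x (\<rho> k0) \<le> x n + e / 2" using n k0 by (intro N) auto
      moreover have "\<bar>x (\<rho> k) - l\<bar> < e / 2" "\<bar>x (\<rho> k0) - l\<bar> < e / 2"
        by (rule K, simp add: k_def k0_def)+
      ultimately show ?thesis unfolding dist_real_def by linarith
    qed
    then show "\<forall>\<^sub>F n in sequentially. dist (x n) l < e" unfolding eventually_sequentially by blast
  qed
  then show ?thesis by (rule convergentI)
qed

text \<open>
  The heart of the converse. The functions \<open>g n\<close> are affine, nonnegative and almost increasing on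
  the dual ball, and \<open>E\<close> is the set where they stay bounded, equivalently where they converge, with
  limit \<open>G\<close>. The conjugate of \<open>g n\<close> is \<open>horo_dist (w n)\<close>; the claim that \<open>\<psi>\<close> is the conjugate of
  \<open>G\<close> uses monotonicity to interchange the limit with the maximum over the compact dual ball.
\<close>
lemma limit_of_almost_increasing_affine_functions:
  fixes w :: "nat \<Rightarrow> 'a::real_normed_vector"
  assumes fd: "finite S" "span S = (UNIV :: 'a set)"
    and inc: "\<And>\<epsilon>. 0 < \<epsilon> \<Longrightarrow> \<exists>N. \<forall>m n q. N \<le> m \<and> m \<le> n \<and> q \<in> dual_ball \<longrightarrow>
      blinfun_apply q (w m) + norm (w m) \<le> blinfun_apply q (w n) + norm (w n) + \<epsilon>"
    and lim: "\<And>x. (\<lambda>n. horo_dist (w n) x) \<longlonglongrightarrow> \<psi> x"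
  obtains E p c where "E face_of dual_ball" "E \<noteq> {}" "\<And>x. \<psi> x = support E (x - p) - c"
proof -
  define g where "g n q = blinfun_apply q (w n) + norm (w n)" for n q
  define E where "E = {q \<in> dual_ball. convergent (\<lambda>n. g n q)}"
  have sub: "E \<subseteq> dual_ball" by (auto simp: E_def)
  have g_nonneg: "0 \<le> g n q" if "q \<in> dual_ball" for n q
    using dual_ball_ge[OF that, of "w n"] by (simp add: g_def)
  have g_inc: "\<exists>N. \<forall>m n q. N \<le> m \<and> m \<le> n \<and> q \<in> dual_ball \<longrightarrow> g m q \<le> g n q + \<epsilon>" if "0 < \<epsilon>" for \<epsilon>
    using inc[OF that] by (simp add: g_def)
  have E_I: "q \<in> E" if q: "q \<in> dual_ball" and b: "\<And>n. N0 \<le> n \<Longrightarrow> g n q \<le> b" for q b N0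
  proof -
    have "convergent (\<lambda>n. g (n + N0) q)"
    proof (rule almost_increasing_bounded_convergent)
      fix \<epsilon> :: real assume "0 < \<epsilon>"
      then obtain N where "\<And>m n q. N \<le> m \<Longrightarrow> m \<le> n \<Longrightarrow> q \<in> dual_ball \<Longrightarrow> g m q \<le> g n q + \<epsilon>"
        using g_inc by blast
      then show "\<exists>N. \<forall>m n. N \<le> m \<and> m \<le> n \<longrightarrow> g (m + N0) q \<le> g (n + N0) q + \<epsilon>"
        using q by (intro exI[of _ N]) auto
    next
      show "bounded (range (\<lambda>n. g (n + N0) q))"
        unfolding bounded_iff using b g_nonneg[OF q] by (intro exI[of _ b]) auto
    qed
    then show ?thesis using q by (simp add: E_def convergent_ignore_initial_segment[of "\<lambda>n. g n q"])
  qed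
  have g_affine: "g n (s *\<^sub>R a + t *\<^sub>R b) = s * g n a + t * g n b" if "s + t = 1" for n s t a b
  proof -
    have "s * g n a + t * g n b = blinfun_apply (s *\<^sub>R a + t *\<^sub>R b) (w n) + (s + t) * norm (w n)"
      by (simp add: g_def blinfun.add_left blinfun.scaleR_left algebra_simps)
    then show ?thesis using that by (simp add: g_def)
  qed
  have comb: "s *\<^sub>R a + t *\<^sub>R b \<in> dual_ball"
    if "a \<in> dual_ball" "b \<in> dual_ball" "0 \<le> s" "0 \<le> t" "s + t = 1" for a b :: "'a \<Rightarrow>\<^sub>L real" and s t
    unfolding dual_ball_iff
  proof
    fix x
    have "s * blinfun_apply a x + t * blinfun_apply b x \<le> s * norm x + t * norm x"
      using that by (intro add_mono mult_left_mono dual_ball_le)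
    then show "blinfun_apply (s *\<^sub>R a + t *\<^sub>R b) x \<le> norm x"
      using that(5) by (simp add: blinfun.add_left blinfun.scaleR_left flip: distrib_right)
  qed
  have face: "E face_of dual_ball"
    unfolding face_of_def
  proof (intro conjI ballI impI)
    show "E \<subseteq> dual_ball" by (rule sub)
    show "convex E"
    proof (rule convexI)
      fix a b and s t :: real
      assume "a \<in> E" "b \<in> E" and s: "0 \<le> s" "0 \<le> t" "s + t = 1"
      then show "s *\<^sub>R a + t *\<^sub>R b \<in> E"
        unfolding E_def g_affine[OF s(3)] mem_Collect_eq
        by (intro conjI comb) (auto intro!: convergent_add convergent_mult convergent_const simp: g_affine)
    qed
    have half: "a \<in> E" if "a \<in> dual_ball" "b \<in> dual_ball" "0 < s" "0 \<le> t" "s + t = 1" "s *\<^sub>R a + t *\<^sub>R b \<in> E"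
      for a b :: "'a \<Rightarrow>\<^sub>L real" and s t :: real
    proof -
      have "convergent (\<lambda>n. g n (s *\<^sub>R a + t *\<^sub>R b))" using that(6) by (simp add: E_def)
      then obtain C where C: "\<And>n. \<bar>g n (s *\<^sub>R a + t *\<^sub>R b)\<bar> \<le> C"
        using convergent_imp_Bseq[THEN BseqD] by (metis real_norm_def)
      have "g n a \<le> C / s" for n
      proof -
        have "s * g n a + t * g n b \<le> C" using C[of n] by (simp add: g_affine[OF that(5)])
        moreover have "0 \<le> t * g n b" using g_nonneg[OF that(2)] that(4) by simp
        ultimately show ?thesis using that(3) by (simp add: field_simps)
      qed
      then show ?thesis using E_I[OF that(1)] by blast
    qed
    fix a b x :: "'a \<Rightarrow>\<^sub>L real"
    assume ab: "a \<in> dual_ball" "b \<in> dual_ball" and x: "x \<in> E" "x \<in> open_segment a b"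
    then obtain u where u: "0 < u" "u < 1" "x = (1 - u) *\<^sub>R a + u *\<^sub>R b" by (auto simp: in_segment)
    show "a \<in> E" using half[of a b "1 - u" u] ab x u by simp
    show "b \<in> E" using half[of b a u "1 - u"] ab x u by (simp add: add.commute)
  qed
  define G where "G q = lim (\<lambda>n. g n q)" for q
  have G: "(\<lambda>n. g n q) \<longlonglongrightarrow> G q" if "q \<in> E" for q
    using that by (simp add: E_def G_def convergent_LIMSEQ_iff)
  have lower: "blinfun_apply q x - G q \<le> \<psi> x" if q: "q \<in> E" for q x
  proof (rule LIMSEQ_le[OF tendsto_diff[OF tendsto_const G[OF q]] lim])
    have "blinfun_apply q x - g n q \<le> horo_dist (w n) x" for n
      using dual_ball_le[of q "x - w n"] q
      by (simp add: g_def horo_dist_def E_def blinfun.diff_right norm_minus_commute)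
    then show "\<exists>N. \<forall>n\<ge>N. blinfun_apply q x - g n q \<le> horo_dist (w n) x" by blast
  qed
  \<comment> \<open>A limit \<open>q'\<close> of maximisers \<open>q n\<close> of \<open>q x - g n q\<close> is a maximiser for the limit: for fixed \<open>m\<close>, the value
    \<open>g m (q n)\<close> is almost below \<open>g n (q n)\<close>, so \<open>g m q'\<close> stays bounded as \<open>m\<close> grows.\<close>
  have attained: "\<exists>q\<in>E. \<psi> x \<le> blinfun_apply q x - G q" for x
  proof -
    have "\<exists>q. \<forall>n. q n \<in> dual_ball \<and> blinfun_apply (q n) (x - w n) = norm (x - w n)"
      using norming_functional[OF fd] by (intro choice allI) metis
    then obtain q where q: "\<And>n. q n \<in> dual_ball" "\<And>n. blinfun_apply (q n) (x - w n) = norm (x - w n)"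
      by blast
    obtain \<rho> q' where \<rho>: "strict_mono (\<rho> :: nat \<Rightarrow> nat)" "q' \<in> dual_ball"
      and conv: "\<forall>x. (\<lambda>n. blinfun_apply (q (\<rho> n)) x) \<longlonglongrightarrow> blinfun_apply q' x"
      using dual_ball_sequentially_compact[of S q, OF fd q(1)] by (elim exE conjE)
    note conv = conv[rule_format]
    have gq: "g n (q n) = blinfun_apply (q n) x - horo_dist (w n) x" for n
      using q(2)[of n] by (simp add: g_def horo_dist_def blinfun.diff_right norm_minus_commute)
    have bound: "\<exists>N. \<forall>m\<ge>N. g m q' \<le> blinfun_apply q' x - \<psi> x + \<epsilon>" if \<epsilon>: "0 < \<epsilon>" for \<epsilon>
    proof -
      obtain N where N: "\<And>m n q. N \<le> m \<Longrightarrow> m \<le> n \<Longrightarrow> q \<in> dual_ball \<Longrightarrow> g m q \<le> g n q + \<epsilon>"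
        using g_inc[OF \<epsilon>] by blast
      have "g m q' \<le> blinfun_apply q' x - \<psi> x + \<epsilon>" if m: "N \<le> m" for m
      proof (rule LIMSEQ_le)
        show "(\<lambda>n. g m (q (\<rho> n))) \<longlonglongrightarrow> g m q'"
          unfolding g_def by (intro tendsto_intros conv)
        show "(\<lambda>n. blinfun_apply (q (\<rho> n)) x - horo_dist (w (\<rho> n)) x + \<epsilon>) \<longlonglongrightarrow> blinfun_apply q' x - \<psi> x + \<epsilon>"
          using LIMSEQ_subseq_LIMSEQ[OF lim \<rho>(1), of x] by (intro tendsto_intros conv) (simp add: o_def)
        have "g m (q (\<rho> n)) \<le> blinfun_apply (q (\<rho> n)) x - horo_dist (w (\<rho> n)) x + \<epsilon>" if "m \<le> n" for n
          using N[OF m, of "\<rho> n" "q (\<rho> n)"] q(1) gq[of "\<rho> n"] seq_suble[OF \<rho>(1), of n] that by simp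
        then show "\<exists>M. \<forall>n\<ge>M. g m (q (\<rho> n)) \<le> blinfun_apply (q (\<rho> n)) x - horo_dist (w (\<rho> n)) x + \<epsilon>"
          by blast
      qed
      then show ?thesis by blast
    qed
    have q'E: "q' \<in> E" using bound[of 1] E_I[OF \<rho>(2)] by (metis zero_less_one)
    have "G q' \<le> blinfun_apply q' x - \<psi> x + \<epsilon>" if "0 < \<epsilon>" for \<epsilon>
      using bound[OF that] by (intro LIMSEQ_le_const2[OF G[OF q'E]])
    then have "G q' \<le> blinfun_apply q' x - \<psi> x" by (rule field_le_epsilon)
    then show ?thesis using q'E by (intro bexI[of _ q']) auto
  qed
  then obtain e0 where e0: "e0 \<in> E" by blast
  then have ne: "E \<noteq> {}" by blast
  \<comment> \<open>Differences of elements of \<open>E\<close> are functionals along which \<open>w\<close> converges weakly; the weak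
    limit on their span is evaluation at a point \<open>p\<close>.\<close>
  define U where "U = {u :: 'a \<Rightarrow>\<^sub>L real. convergent (\<lambda>n. blinfun_apply u (w n))}"
  have "subspace U"
    unfolding U_def subspace_def
    by (auto simp: blinfun.add_left blinfun.scaleR_left
        intro!: convergent_add convergent_mult convergent_const)
  define L where "L u = lim (\<lambda>n. blinfun_apply u (w n))" for u :: "'a \<Rightarrow>\<^sub>L real"
  have L: "(\<lambda>n. blinfun_apply u (w n)) \<longlonglongrightarrow> L u" if "u \<in> U" for u
    using that by (simp add: U_def L_def convergent_LIMSEQ_iff)
  have L_lin: "L (u + c *\<^sub>R v) = L u + c * L v" if "u \<in> U" "v \<in> U" for u v c
  proof (rule LIMSEQ_unique[OF L])
    show "u + c *\<^sub>R v \<in> U" using that \<open>subspace U\<close> by (intro subspace_add subspace_scale)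
    show "(\<lambda>n. blinfun_apply (u + c *\<^sub>R v) (w n)) \<longlonglongrightarrow> L u + c * L v"
      unfolding blinfun.add_left blinfun.scaleR_left real_scaleR_def
      using that by (intro tendsto_intros L)
  qed
  obtain p where p: "\<And>u. u \<in> U \<Longrightarrow> L u = blinfun_apply u p"
    using dual_functional_is_evaluation[OF fd \<open>subspace U\<close>, of L] L_lin by blast
  define c where "c = G e0 - blinfun_apply e0 p"
  have Gp: "G q = blinfun_apply q p + c" if q: "q \<in> E" for q
  proof -
    have "(\<lambda>n. g n q - g n e0) \<longlonglongrightarrow> G q - G e0" by (intro tendsto_diff G q e0)
    then have *: "(\<lambda>n. blinfun_apply (q - e0) (w n)) \<longlonglongrightarrow> G q - G e0"
      by (simp add: g_def blinfun.diff_left)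
    then have "q - e0 \<in> U" by (auto simp: U_def convergent_def)
    from LIMSEQ_unique[OF * L[OF this]] p[OF this] show ?thesis by (simp add: c_def blinfun.diff_left)
  qed
  have "\<psi> x = support E (x - p) - c" for x
  proof (rule antisym)
    obtain q where "q \<in> E" "\<psi> x \<le> blinfun_apply q x - G q" using attained by blast
    then show "\<psi> x \<le> support E (x - p) - c"
      using support_upper[OF sub, of q "x - p"] Gp[of q] by (simp add: blinfun.diff_right)
    have "support E (x - p) \<le> \<psi> x + c"
      by (rule support_least[OF ne]) (use lower[of _ x] Gp in \<open>force simp: blinfun.diff_right\<close>)
    then show "support E (x - p) - c \<le> \<psi> x" by simp
  qed
  then show ?thesis using that face ne by blast
qed

text \<open>
  The parameters are chosen increasing, so that the almost-geodesic inequality applies to any two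
  late members of the sequence.
\<close>
lemma almost_geodesic_sequence:
  assumes "almost_geodesic T \<gamma>"
  obtains \<tau> :: "nat \<Rightarrow> real" where "filterlim \<tau> (inf at_top (principal T)) sequentially"
    "\<And>\<epsilon>. 0 < \<epsilon> \<Longrightarrow> \<exists>N. \<forall>m n. N \<le> m \<and> m \<le> n \<longrightarrow>
      \<bar>dist (\<gamma> (\<tau> n)) (\<gamma> (\<tau> m)) + dist (\<gamma> (\<tau> m)) (\<gamma> 0) - \<tau> n\<bar> < \<epsilon>"
proof -
  have T: "T \<subseteq> {0..}" "\<not> bounded T"
    and ag: "\<And>e. 0 < e \<Longrightarrow> \<exists>M. \<forall>s\<in>T. \<forall>t\<in>T. M \<le> s \<and> s \<le> t \<longrightarrow>
        \<bar>dist (\<gamma> t) (\<gamma> s) + dist (\<gamma> s) (\<gamma> 0) - t\<bar> < e"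
    using assms unfolding almost_geodesic_def by auto
  have large: "\<exists>t\<in>T. b \<le> t" for b
  proof (rule ccontr)
    assume "\<not> ?thesis"
    then have "T \<subseteq> {0..b}" using T(1) by force
    then show False using T(2) bounded_closed_interval bounded_subset by metis
  qed
  have "\<exists>\<tau>. \<forall>n. (\<tau> n \<in> T \<and> real n \<le> \<tau> n) \<and> \<tau> n \<le> \<tau> (Suc n)"
  proof (rule dependent_nat_choice)
    show "\<exists>t. t \<in> T \<and> real 0 \<le> t" using large by blast
    show "\<exists>t'. (t' \<in> T \<and> real (Suc n) \<le> t') \<and> t \<le> t'" for t n
      using large[of "max t (real (Suc n))"] by auto
  qed
  then obtain \<tau> where \<tau>: "\<And>n. \<tau> n \<in> T" "\<And>n. real n \<le> \<tau> n" "\<And>n. \<tau> n \<le> \<tau> (Suc n)" by blast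
  have mono: "m \<le> n \<Longrightarrow> \<tau> m \<le> \<tau> n" for m n
    using \<tau>(3) by (rule lift_Suc_mono_le)
  show ?thesis
  proof
    have "filterlim \<tau> at_top sequentially"
      using \<tau>(2) by (intro filterlim_at_top_mono[OF filterlim_real_sequentially] always_eventually) auto
    then show "filterlim \<tau> (inf at_top (principal T)) sequentially"
      using \<tau>(1) by (simp add: filterlim_inf filterlim_principal)
    fix \<epsilon> :: real assume "0 < \<epsilon>"
    then obtain M where M: "\<And>s t. s \<in> T \<Longrightarrow> t \<in> T \<Longrightarrow> M \<le> s \<Longrightarrow> s \<le> t \<Longrightarrow>
      \<bar>dist (\<gamma> t) (\<gamma> s) + dist (\<gamma> s) (\<gamma> 0) - t\<bar> < \<epsilon>" using ag by blast
    obtain N where N: "M \<le> real N" using real_arch_simple by blast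
    have "M \<le> \<tau> m" if "N \<le> m" for m using N \<tau>(2)[of m] that by (meson of_nat_mono order_trans)
    then show "\<exists>N. \<forall>m n. N \<le> m \<and> m \<le> n \<longrightarrow>
      \<bar>dist (\<gamma> (\<tau> n)) (\<gamma> (\<tau> m)) + dist (\<gamma> (\<tau> m)) (\<gamma> 0) - \<tau> n\<bar> < \<epsilon>"
      using M \<tau>(1) mono by blast
  qed
qed

text \<open>
  Subtracting \<open>\<gamma> 0\<close> lets the almost-geodesic start at the origin; its inequality, together with the
  case \<open>s = t\<close>, becomes \<open>\<parallel>w n - w m\<parallel> + \<parallel>w m\<parallel> \<le> \<parallel>w n\<parallel> + \<epsilon>\<close>, and testing it against \<open>q\<close> in the dual
  ball gives monotonicity. The constant in the limit is fixed by \<open>h 0 = 0\<close>.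
\<close>
lemma busemann_point_is_face_function:
  fixes h :: "'a::real_normed_vector \<Rightarrow> real"
  assumes fd: "finite S" "span S = (UNIV :: 'a set)" and h: "h \<in> busemann_points"
  obtains E p where "E face_of dual_ball" "E \<noteq> {}" "E \<noteq> dual_ball"
    "h = (\<lambda>x. support E (x - p) - support E (- p))"
proof -
  obtain T \<gamma> where ag: "almost_geodesic T \<gamma>"
    and unif: "\<And>K. compact K \<Longrightarrow> uniform_limit K (\<lambda>t. horo_dist (\<gamma> t)) h (inf at_top (principal T))"
    and notin: "h \<notin> range horo_dist"
    using h unfolding busemann_points_def horofunctions_def by blast
  obtain \<tau> :: "nat \<Rightarrow> real" where \<tau>: "filterlim \<tau> (inf at_top (principal T)) sequentially"
    and ag': "\<And>\<epsilon>. 0 < \<epsilon> \<Longrightarrow> \<exists>N. \<forall>m n. N \<le> m \<and> m \<le> n \<longrightarrow>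
      \<bar>dist (\<gamma> (\<tau> n)) (\<gamma> (\<tau> m)) + dist (\<gamma> (\<tau> m)) (\<gamma> 0) - \<tau> n\<bar> < \<epsilon>"
    using almost_geodesic_sequence[OF ag] by blast
  have lim: "(\<lambda>n. horo_dist (\<gamma> (\<tau> n)) x) \<longlonglongrightarrow> h x" for x
    using filterlim_compose[OF tendsto_uniform_limitI[OF unif[of "{x}"]] \<tau>] by simp
  define w where "w n = \<gamma> (\<tau> n) - \<gamma> 0" for n
  have inc: "\<exists>N. \<forall>m n q. N \<le> m \<and> m \<le> n \<and> q \<in> dual_ball \<longrightarrow>
      blinfun_apply q (w m) + norm (w m) \<le> blinfun_apply q (w n) + norm (w n) + \<epsilon>" if \<epsilon>: "0 < \<epsilon>" for \<epsilon>
  proof -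
    obtain N where "\<And>m n. N \<le> m \<Longrightarrow> m \<le> n \<Longrightarrow>
      \<bar>dist (\<gamma> (\<tau> n)) (\<gamma> (\<tau> m)) + dist (\<gamma> (\<tau> m)) (\<gamma> 0) - \<tau> n\<bar> < \<epsilon> / 2"
      using ag'[of "\<epsilon> / 2"] \<epsilon> by auto
    then have N: "\<bar>norm (w n - w m) + norm (w m) - \<tau> n\<bar> < \<epsilon> / 2" if "N \<le> m" "m \<le> n" for m n
      using that by (simp add: w_def dist_norm)
    show ?thesis
    proof (intro exI[of _ N] allI impI)
      fix m n and q :: "'a \<Rightarrow>\<^sub>L real" assume mn: "N \<le> m \<and> m \<le> n \<and> q \<in> dual_ball"
      have "\<bar>norm (w n - w m) + norm (w m) - \<tau> n\<bar> < \<epsilon> / 2" using mn by (intro N) auto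
      moreover have "\<bar>norm (w n) - \<tau> n\<bar> < \<epsilon> / 2" using N[of n n] mn by simp
      moreover have "- norm (w n - w m) \<le> blinfun_apply q (w n - w m)" using mn by (intro dual_ball_ge) auto
      ultimately show "blinfun_apply q (w m) + norm (w m) \<le> blinfun_apply q (w n) + norm (w n) + \<epsilon>"
        unfolding blinfun.diff_right by linarith
    qed
  qed
  have lim_w: "(\<lambda>n. horo_dist (w n) x) \<longlonglongrightarrow> h (x + \<gamma> 0) - h (\<gamma> 0)" for x
  proof -
    have "(\<lambda>n. horo_dist (\<gamma> (\<tau> n)) (x + \<gamma> 0) - horo_dist (\<gamma> (\<tau> n)) (\<gamma> 0)) \<longlonglongrightarrow> h (x + \<gamma> 0) - h (\<gamma> 0)"
      by (intro tendsto_diff lim)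
    then show ?thesis by (simp add: horo_dist_def w_def algebra_simps)
  qed
  obtain E p' c where E: "E face_of dual_ball" "E \<noteq> {}"
    and eq: "\<And>x. h (x + \<gamma> 0) - h (\<gamma> 0) = support E (x - p') - c"
    using limit_of_almost_increasing_affine_functions[OF fd inc lim_w] by blast
  have h0: "h 0 = 0" by (rule LIMSEQ_unique[OF lim[of 0]]) (simp add: horo_dist_def)
  define p where "p = \<gamma> 0 + p'"
  have hE: "h = (\<lambda>x. support E (x - p) - support E (- p))"
  proof
    show "h x = support E (x - p) - support E (- p)" for x
      using eq[of "x - \<gamma> 0"] eq[of "- \<gamma> 0"] h0 by (simp add: p_def diff_diff_eq)
  qed
  have "E \<noteq> dual_ball"
  proof
    assume "E = dual_ball"
    then have "h = horo_dist p"
      by (simp add: hE support_dual_ball[OF fd] horo_dist_def[abs_def] norm_minus_commute)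
    then show False using notin by blast
  qed
  then show ?thesis using that E hE by blast
qed

theorem theorem1p1:
  assumes "\<exists>S :: 'a::real_normed_vector set. finite S \<and> span S = UNIV"
  shows "(\<lambda>h x. ereal (h x)) ` (busemann_points :: ('a \<Rightarrow> real) set) =
    {legendre_fenchel (face_fun E p) |E p. E face_of dual_ball \<and> E \<noteq> {} \<and> E \<noteq> dual_ball}"
proof -
  obtain S :: "'a set" where fd: "finite S" "span S = UNIV" using assms by blast
  have ereal_eq: "(\<lambda>x. ereal (support E (x - p) - support E (- p))) = legendre_fenchel (face_fun E p)"
    if "E face_of dual_ball" "E \<noteq> {}" for E and p :: 'a
    using legendre_fenchel_face_fun[of E p] that by (auto simp: face_of_def)
  show ?thesis
  proof (intro equalityI subsetI)
    fix f assume "f \<in> (\<lambda>h x. ereal (h x)) ` (busemann_points :: ('a \<Rightarrow> real) set)"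
    then obtain h :: "'a \<Rightarrow> real" where h: "h \<in> busemann_points" "f = (\<lambda>x. ereal (h x))" by blast
    obtain E p where "E face_of dual_ball" "E \<noteq> {}" "E \<noteq> dual_ball"
      "h = (\<lambda>x. support E (x - p) - support E (- p))"
      using busemann_point_is_face_function[OF fd h(1)] .
    then show "f \<in> {legendre_fenchel (face_fun E p) |E p. E face_of dual_ball \<and> E \<noteq> {} \<and> E \<noteq> dual_ball}"
      using ereal_eq[of E p] h(2) by auto
  next
    fix f :: "'a \<Rightarrow> ereal"
    assume "f \<in> {legendre_fenchel (face_fun E p) |E p. E face_of dual_ball \<and> E \<noteq> {} \<and> E \<noteq> dual_ball}"
    then obtain E p where E: "E face_of dual_ball" "E \<noteq> {}" "E \<noteq> dual_ball"
      and f: "f = legendre_fenchel (face_fun E p)" by blast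
    then show "f \<in> (\<lambda>h x. ereal (h x)) ` busemann_points"
      unfolding f ereal_eq[OF E(1,2), symmetric]
      by (intro image_eqI[OF refl] face_function_busemann[OF fd E])
  qed
qed

end
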